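(* For every $k\in\Lambda$, $$\widetilde\Delta_k=-\sum_{k'\in\Lambda}U_{k,k'}\left(\widetilde\Psi,C_{-k'\downarrow}C_{k'\uparrow}\widetilde\Psi\right).$$
   Context: Fix (large) real numbers $L,K_{max}>0$ and let $\Lambda=\{\frac{2\pi}{L}(n_1,n_2,n_3)\in\mathbb{R}^3: n_1,n_2,n_3\in\mathbb{Z},\ \frac{2\pi}{L}\sqrt{n_1^2+n_2^2+n_3^2}\le K_{max}\}$, a finite set with $M$ elements, whose elements are arranged in a fixed order. Let $\mathcal{H}=\mathbb{C}^{2^{2M}}$ with its standard inner product $(\cdot,\cdot)$; its standard unit vectors are labelled $|n_{k\uparrow},n_{k\downarrow},n_{k'\uparrow},n_{k'\downarrow},\ldots\rangle$ with $n_{k\sigma}\in\{0,1\}$, $k\in\Lambda$, $\sigma\in\{\uparrow,\downarrow\}$, and $|0\rangle$ denotes the one with all $n_{k\sigma}=0$. The annihilation operator $C_{k\sigma}$ is the linear operator on $\mathcal{H}$ which sends a standard unit vector with $n_{k\sigma}=1$ to $(-1)^{s}$ times the standard unit vector obtained by replacing $n_{k\sigma}$ by $0$, where $s$ is the sum of the occupation numbers to the left of $n_{k\sigma}$, and sends a standard unit vector with $n_{k\sigma}=0$ to $0$. The creation operator $C_{k\sigma}^*$ sends a standard unit vector with $n_{k\sigma}=0$ to $(-1)^{s}$ times the one with $n_{k\sigma}$ replaced by $1$ (same $s$), and one with $n_{k\sigma}=1$ to $0$; it is the adjoint of $C_{k\sigma}$. Let $m,\mu,\hbar>0$ and $\xi_k=\hbar^2|k|^2/(2m)-\mu$.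 Let $U_{k,k'}$ ($k,k'\in\Lambda$) be real with $U_{k,k'}\le 0$, $U_{k',k}=U_{k,k'}$, $U_{-k,-k'}=U_{k,k'}$, $U_{k,k}=0$. It is assumed that there is a function $\widetilde\Delta_k\ge0$ of $k\in\Lambda$ with $\widetilde\Delta_{-k}=\widetilde\Delta_k$ and $\widetilde E_k:=\sqrt{\xi_k^2+\widetilde\Delta_k^2}>0$ for all $k$, solving the new gap equation $$\widetilde\Delta_k=-\frac12\sum_{k'\in\Lambda}U_{k,k'}\frac{\widetilde\Delta_{k'}}{\widetilde E_{k'}}\left(1-\frac{4D_{k'}}{D+2}\right),\quad D_{k'}=\frac14\sum_{p\in\Lambda}\frac{U_{k',p}^2}{(\widetilde E_{k'}+\widetilde E_p)^2}\left(1-\frac{\xi_{k'}\xi_p}{\widetilde E_{k'}\widetilde E_p}\right)^2,\quad D=\sum_{k'\in\Lambda}D_{k'};$$ fix such a $\widetilde\Delta$. Let $\widetilde\theta_k\in[0,\pi/2]$ satisfy $\sin2\widetilde\theta_k=\widetilde\Delta_k/\widetilde E_k$, $\cos2\widetilde\theta_k=\xi_k/\widetilde E_k$. Let $\widetilde G_B=i\sum_{k\in\Lambda}\widetilde\theta_k(C_{-k\downarrow}C_{k\uparrow}-C_{k\uparrow}^*C_{-k\downarrow}^* )$, $\widetilde\Psi_{BCS}=e^{i\widetilde G_B}|0\rangle$, $\widetilde\gamma_{k\sigma}=e^{i\widetilde G_B}C_{k\sigma}e^{-i\widetilde G_B}$ (adjoint $\widetilde\gamma_{k\sigma}^*$),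 and write $\widetilde S_k=\sin\widetilde\theta_k$, $\widetilde C_k=\cos\widetilde\theta_k$. Put $$\widetilde\Phi=\frac12\sum_{p,p'\in\Lambda}\frac{U_{p,p'}(\widetilde C_p^2\widetilde S_{p'}^2+\widetilde C_{p'}^2\widetilde S_p^2)}{\widetilde E_p+\widetilde E_{p'}}\widetilde\gamma_{p\uparrow}^*\widetilde\gamma_{-p\downarrow}^*\widetilde\gamma_{p'\uparrow}^*\widetilde\gamma_{-p'\downarrow}^*\widetilde\Psi_{BCS},\qquad\widetilde\Psi=\frac{\widetilde\Psi_{BCS}+\widetilde\Phi}{\sqrt{1+(\widetilde\Phi,\widetilde\Phi)}}.$$ *)

theory Defs
  imports "HOL-Analysis.Analysis" "Jordan_Normal_Form.Schur_Decomposition"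
begin

text \<open>Momenta are vectors in \<open>real ^ 3\<close> with the Euclidean norm; operators and states on
  the Fock space are matrices and vectors of \<open>Jordan_Normal_Form.Matrix\<close>. The constants and
  types \<open>vec\<close> and \<open>mat\<close> are qualified because HOL-Analysis uses the same names.\<close>

definition momenta :: "real \<Rightarrow> real \<Rightarrow> (real ^ 3) set" where
  "momenta L Kmax =
     {(2 * pi / L) *\<^sub>R vector [real_of_int n1, real_of_int n2, real_of_int n3] | n1 n2 n3.
        2 * pi / L * sqrt ((real_of_int n1)\<^sup>2 + (real_of_int n2)\<^sup>2 + (real_of_int n3)\<^sup>2) \<le> Kmax}"

datatype spin = Up | Down

text \<open>The list \<open>ks\<close> is the chosen order of the momenta, \<open>M = length ks\<close>. The standard unit
  vectors of the Fock space \<open>carrier_vec (2 ^ (2 * M))\<close> are labelled by reading the index in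
  binary: bit \<open>mode ks k \<sigma>\<close> of the index is the occupation number of \<open>(k, \<sigma>)\<close>, and the modes
  are numbered from the left, in the order \<open>ks ! 0 \<up>, ks ! 0 \<down>, ks ! 1 \<up>, ks ! 1 \<down>, \<dots>\<close>\<close>

definition fock_dim :: "(real ^ 3) list \<Rightarrow> nat" where
  "fock_dim ks = 2 ^ (2 * length ks)"

definition mode :: "(real ^ 3) list \<Rightarrow> real ^ 3 \<Rightarrow> spin \<Rightarrow> nat" where
  "mode ks k \<sigma> =
     2 * (THE j. j < length ks \<and> ks ! j = k) + (case \<sigma> of Up \<Rightarrow> 0 | Down \<Rightarrow> 1)"

definition occ_left :: "nat \<Rightarrow> nat \<Rightarrow> nat" where
  "occ_left p n = (\<Sum>q<p. of_bool (bit n q))"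

definition vacuum :: "(real ^ 3) list \<Rightarrow> complex Matrix.vec" where
  "vacuum ks = unit_vec (fock_dim ks) 0"

text \<open>Column \<open>n\<close> is the image of the standard unit vector with label \<open>n\<close>.\<close>

definition annih :: "(real ^ 3) list \<Rightarrow> real ^ 3 \<Rightarrow> spin \<Rightarrow> complex Matrix.mat" where
  "annih ks k \<sigma> =
     (let N = fock_dim ks; p = mode ks k \<sigma> in
      mat_of_cols N (map (\<lambda>n. if bit n p
          then (-1) ^ occ_left p n \<cdot>\<^sub>v unit_vec N (unset_bit p n)
          else 0\<^sub>v N) [0..<N]))"

definition creat :: "(real ^ 3) list \<Rightarrow> real ^ 3 \<Rightarrow> spin \<Rightarrow> complex Matrix.mat" where
  "creat ks k \<sigma> =
     (let N = fock_dim ks; p = mode ks k \<sigma> in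
      mat_of_cols N (map (\<lambda>n. if bit n p
          then 0\<^sub>v N
          else (-1) ^ occ_left p n \<cdot>\<^sub>v unit_vec N (set_bit p n)) [0..<N]))"

text \<open>Linear in the second argument, whereas the operation \<open>\<bullet>c\<close> is linear in the first.\<close>

definition fock_inner :: "complex Matrix.vec \<Rightarrow> complex Matrix.vec \<Rightarrow> complex" where
  "fock_inner u v = v \<bullet>c u"

definition mat_exp :: "complex Matrix.mat \<Rightarrow> complex Matrix.mat" where
  "mat_exp A = Matrix.mat (dim_row A) (dim_row A)
     (\<lambda>(i, j). \<Sum>n. (A ^\<^sub>m n) $$ (i, j) / fact n)"

definition gen_B :: "(real ^ 3) list \<Rightarrow> (real ^ 3 \<Rightarrow> real) \<Rightarrow> complex Matrix.mat" where
  "gen_B ks \<theta> = \<i> \<cdot>\<^sub>m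
     finsum (module_mat TYPE(complex) (fock_dim ks) (fock_dim ks))
       (\<lambda>k. complex_of_real (\<theta> k) \<cdot>\<^sub>m
          (annih ks (-k) Down * annih ks k Up - creat ks k Up * creat ks (-k) Down))
       (set ks)"

definition psi_BCS :: "(real ^ 3) list \<Rightarrow> (real ^ 3 \<Rightarrow> real) \<Rightarrow> complex Matrix.vec" where
  "psi_BCS ks \<theta> = mat_exp (\<i> \<cdot>\<^sub>m gen_B ks \<theta>) *\<^sub>v vacuum ks"

definition gam :: "(real ^ 3) list \<Rightarrow> (real ^ 3 \<Rightarrow> real) \<Rightarrow> real ^ 3 \<Rightarrow> spin \<Rightarrow> complex Matrix.mat" where
  "gam ks \<theta> k \<sigma> =
     mat_exp (\<i> \<cdot>\<^sub>m gen_B ks \<theta>) * annih ks k \<sigma> * mat_exp ((-\<i>) \<cdot>\<^sub>m gen_B ks \<theta>)"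

abbreviation gam_adj :: "(real ^ 3) list \<Rightarrow> (real ^ 3 \<Rightarrow> real) \<Rightarrow> real ^ 3 \<Rightarrow> spin \<Rightarrow> complex Matrix.mat" where
  "gam_adj ks \<theta> k \<sigma> \<equiv> mat_adjoint (gam ks \<theta> k \<sigma>)"

definition xi :: "real \<Rightarrow> real \<Rightarrow> real \<Rightarrow> real ^ 3 \<Rightarrow> real" where
  "xi hbar m \<mu> k = hbar\<^sup>2 * (norm k)\<^sup>2 / (2 * m) - \<mu>"

definition energy :: "(real ^ 3 \<Rightarrow> real) \<Rightarrow> (real ^ 3 \<Rightarrow> real) \<Rightarrow> real ^ 3 \<Rightarrow> real" where
  "energy \<xi> \<Delta> k = sqrt ((\<xi> k)\<^sup>2 + (\<Delta> k)\<^sup>2)"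

definition D_mom :: "(real ^ 3) set \<Rightarrow> (real ^ 3 \<Rightarrow> real ^ 3 \<Rightarrow> real) \<Rightarrow> (real ^ 3 \<Rightarrow> real)
    \<Rightarrow> (real ^ 3 \<Rightarrow> real) \<Rightarrow> real ^ 3 \<Rightarrow> real" where
  "D_mom \<Lambda> U \<xi> E k = 1 / 4 * (\<Sum>p\<in>\<Lambda>. (U k p)\<^sup>2 / (E k + E p)\<^sup>2
     * (1 - \<xi> k * \<xi> p / (E k * E p))\<^sup>2)"

definition D_total :: "(real ^ 3) set \<Rightarrow> (real ^ 3 \<Rightarrow> real ^ 3 \<Rightarrow> real) \<Rightarrow> (real ^ 3 \<Rightarrow> real)
    \<Rightarrow> (real ^ 3 \<Rightarrow> real) \<Rightarrow> real" where
  "D_total \<Lambda> U \<xi> E = (\<Sum>k\<in>\<Lambda>. D_mom \<Lambda> U \<xi> E k)"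

definition phi :: "(real ^ 3) list \<Rightarrow> (real ^ 3 \<Rightarrow> real ^ 3 \<Rightarrow> real) \<Rightarrow> (real ^ 3 \<Rightarrow> real)
    \<Rightarrow> (real ^ 3 \<Rightarrow> real) \<Rightarrow> complex Matrix.vec" where
  "phi ks U E \<theta> = (1 / 2) \<cdot>\<^sub>v finsum_vec TYPE(complex) (fock_dim ks)
     (\<lambda>(p, p'). complex_of_real
          (U p p' * ((cos (\<theta> p))\<^sup>2 * (sin (\<theta> p'))\<^sup>2 + (cos (\<theta> p'))\<^sup>2 * (sin (\<theta> p))\<^sup>2)
             / (E p + E p')) \<cdot>\<^sub>v
        (gam_adj ks \<theta> p Up * gam_adj ks \<theta> (-p) Down
           * gam_adj ks \<theta> p' Up * gam_adj ks \<theta> (-p') Down *\<^sub>v psi_BCS ks \<theta>))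
     (set ks \<times> set ks)"

text \<open>\<open>fock_inner v v\<close> is a nonnegative real, embedded in the complex numbers; hence \<open>Re\<close>.\<close>

definition psi :: "(real ^ 3) list \<Rightarrow> (real ^ 3 \<Rightarrow> real ^ 3 \<Rightarrow> real) \<Rightarrow> (real ^ 3 \<Rightarrow> real)
    \<Rightarrow> (real ^ 3 \<Rightarrow> real) \<Rightarrow> complex Matrix.vec" where
  "psi ks U E \<theta> =
     complex_of_real (1 / sqrt (1 + Re (fock_inner (phi ks U E \<theta>) (phi ks U E \<theta>)))) \<cdot>\<^sub>v
       (psi_BCS ks \<theta> + phi ks U E \<theta>)"

end

theory Submission
  imports Defs
begin

text \<open>Let \<open>b\<^sub>k = C\<^bsub>-k\<down>\<^esub> C\<^bsub>k\<up>\<^esub>\<close>. These operators commute with each other and with each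
  other's adjoints, and \<open>b\<^sub>k\<^sup>2 = 0\<close>, \<open>b\<^sub>k b\<^sub>k\<^sup>* b\<^sub>k = b\<^sub>k\<close>. With \<open>Z\<^sub>k = [b\<^sub>k, b\<^sub>k\<^sup>*]\<close> the operators
  \<open>b\<^sub>k + b\<^sub>k\<^sup>* \<plusminus> i Z\<^sub>k\<close> and \<open>b\<^sub>k - b\<^sub>k\<^sup>*\<close> are eigenvectors of the commutator with the generator of the
  Bogoliubov transformation, so conjugating by it multiplies them by phases. Hence \<open>b\<^sub>k\<close> becomes
  \<open>1/2 sin 2\<theta>\<^sub>k Z\<^sub>k\<close> plus terms that change the number of pairs. In the untransformed picture
  the state is the vacuum plus a combination of two-pair states with coefficients \<open>w\<^bsub>p,p'\<^esub>\<close>, on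
  which those terms have expectation zero, while before normalization \<open>Z\<^sub>k = 1 - 2 b\<^sub>k\<^sup>* b\<^sub>k\<close> has expectation
  \<open>1 + 1/2 \<Sum> w\<^bsub>p,p'\<^esub>\<^sup>2 - 2 \<Sum>\<^sub>p w\<^bsub>k,p\<^esub>\<^sup>2\<close>. Since \<open>w\<^bsub>k,p\<^esub>\<^sup>2\<close> is the summand of \<open>D\<^sub>k\<close>, the new gap equation
  is the claim.\<close>

unbundle no vec_syntax

section \<open>The exponential of a complex matrix\<close>

lemma mult_mat_entry:
  fixes A B :: "'a :: comm_semiring_0 Matrix.mat"
  assumes "A \<in> carrier_mat n m" "B \<in> carrier_mat m r" "i < n" "j < r"
  shows "(A * B) $$ (i, j) = (\<Sum>l<m. A $$ (i, l) * B $$ (l, j))"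
  using assms by (auto simp: scalar_prod_def lessThan_atLeast0 intro!: sum.cong)

lemma mult_mat_vec_entry:
  fixes A :: "'a :: comm_semiring_0 Matrix.mat"
  assumes "A \<in> carrier_mat n m" "v \<in> carrier_vec m" "i < n"
  shows "(A *\<^sub>v v) $ i = (\<Sum>l<m. A $$ (i, l) * v $ l)"
  using assms by (auto simp: scalar_prod_def lessThan_atLeast0 intro!: sum.cong)

text \<open>The sum of the moduli of all entries dominates every column sum, so one more factor
  multiplies the bound by at most this sum. The exponential series is thereby majorized entrywise by
  a real one.\<close>

lemma pow_mat_entry_bound:
  fixes A :: "complex Matrix.mat"
  assumes A: "A \<in> carrier_mat N N" and "i < N" "j < N"
  shows "norm ((A ^\<^sub>m n) $$ (i, j)) \<le> (\<Sum>k<N. \<Sum>l<N. norm (A $$ (k, l))) ^ n"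
  using assms(2,3)
proof (induction n arbitrary: i j)
  case 0
  then show ?case using A by (auto simp: norm_one)
next
  case (Suc n)
  let ?K = "\<Sum>k<N. \<Sum>l<N. norm (A $$ (k, l))"
  have "norm ((A ^\<^sub>m Suc n) $$ (i, j)) = norm (\<Sum>l<N. (A ^\<^sub>m n) $$ (i, l) * A $$ (l, j))"
    using mult_mat_entry[of "A ^\<^sub>m n" N N A N i j] A Suc.prems by simp
  also have "\<dots> \<le> (\<Sum>l<N. ?K ^ n * norm (A $$ (l, j)))"
    by (rule order.trans[OF norm_sum]) (intro sum_mono, auto simp: norm_mult intro!: mult_right_mono Suc)
  also have "\<dots> = ?K ^ n * (\<Sum>l<N. norm (A $$ (l, j)))"
    by (simp add: sum_distrib_left)
  also have "\<dots> \<le> ?K ^ n * ?K"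
    using Suc.prems by (intro mult_left_mono sum_mono member_le_sum zero_le_power sum_nonneg) auto
  finally show ?case by (simp add: mult.commute)
qed

lemma summable_mat_exp_entry:
  fixes A :: "complex Matrix.mat"
  assumes "A \<in> carrier_mat N N" "i < N" "j < N"
  shows "summable (\<lambda>n. norm ((A ^\<^sub>m n) $$ (i, j) / fact n))"
proof (rule summable_comparison_test'[where N = 0])
  let ?K = "\<Sum>k<N. \<Sum>l<N. norm (A $$ (k, l))"
  show "summable (\<lambda>n. ?K ^ n / fact n)"
    using summable_exp[of ?K] by (simp add: field_simps)
  show "norm (norm ((A ^\<^sub>m n) $$ (i, j) / fact n)) \<le> ?K ^ n / fact n" for n
    using pow_mat_entry_bound[OF assms, of n] by (simp add: norm_divide divide_right_mono)
qed

lemma mat_exp_carrier [simp]: "A \<in> carrier_mat N N \<Longrightarrow> mat_exp A \<in> carrier_mat N N"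
  by (simp add: mat_exp_def)

lemma mat_exp_entry:
  "A \<in> carrier_mat N N \<Longrightarrow> i < N \<Longrightarrow> j < N \<Longrightarrow>
    mat_exp A $$ (i, j) = (\<Sum>n. (A ^\<^sub>m n) $$ (i, j) / fact n)"
  by (simp add: mat_exp_def)

lemma pow_mat_intertwine:
  fixes A :: "'a :: comm_semiring_1 Matrix.mat"
  assumes [simp]: "A \<in> carrier_mat N N" "B \<in> carrier_mat N N" "W \<in> carrier_mat N N"
    and "A * W = W * B"
  shows "A ^\<^sub>m n * W = W * B ^\<^sub>m n"
proof (induction n)
  case (Suc n)
  have "A ^\<^sub>m Suc n * W = A ^\<^sub>m n * (A * W)"
    by (simp add: assoc_mult_mat[of _ N N _ N _ N])
  also have "\<dots> = (A ^\<^sub>m n * W) * B"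
    by (simp add: assms(4) assoc_mult_mat[of _ N N _ N _ N])
  also have "\<dots> = W * B ^\<^sub>m Suc n"
    by (simp add: Suc assoc_mult_mat[of _ N N _ N _ N])
  finally show ?case .
qed (simp add: carrier_matD[OF assms(1)] carrier_matD[OF assms(2)] left_mult_one_mat[OF assms(3)] right_mult_one_mat[OF assms(3)])

text \<open>Intertwining passes to all powers. At a fixed entry, multiplication by \<open>W\<close>
  is a finite sum, which may be exchanged with the series.\<close>

lemma mat_exp_intertwine:
  assumes [simp]: "A \<in> carrier_mat N N" "B \<in> carrier_mat N N" "W \<in> carrier_mat N N"
    and AW: "A * W = W * B"
  shows "mat_exp A * W = W * mat_exp B"
proof (rule eq_matI)
  fix i j assume "i < dim_row (W * mat_exp B)" "j < dim_col (W * mat_exp B)"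
  then have ij [simp]: "i < N" "j < N"
    by (simp_all add: carrier_matD[OF mat_exp_carrier, of B N] carrier_matD[OF assms(3)])
  have sA: "summable (\<lambda>n. (A ^\<^sub>m n) $$ (i, l) / fact n)" if "l < N" for l
    using summable_norm_cancel[OF summable_mat_exp_entry[OF assms(1) ij(1) that]] .
  have sB: "summable (\<lambda>n. (B ^\<^sub>m n) $$ (l, j) / fact n)" if "l < N" for l
    using summable_norm_cancel[OF summable_mat_exp_entry[OF assms(2) that ij(2)]] .
  have "(mat_exp A * W) $$ (i, j) = (\<Sum>l<N. (\<Sum>n. (A ^\<^sub>m n) $$ (i, l) / fact n) * W $$ (l, j))"
    by (simp add: mult_mat_entry[of _ N N _ N] mat_exp_entry[of _ N])
  also have "\<dots> = (\<Sum>n. \<Sum>l<N. (A ^\<^sub>m n) $$ (i, l) / fact n * W $$ (l, j))"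
    by (subst suminf_sum) (auto intro!: sum.cong suminf_mult2 sA summable_mult2 simp del: times_divide_eq_left)
  also have "\<dots> = (\<Sum>n. (A ^\<^sub>m n * W) $$ (i, j) / fact n)"
    by (simp add: mult_mat_entry[of _ N N _ N] sum_divide_distrib)
  also have "\<dots> = (\<Sum>n. (W * B ^\<^sub>m n) $$ (i, j) / fact n)"
    by (simp add: pow_mat_intertwine[of A N B, OF _ _ _ AW])
  also have "\<dots> = (\<Sum>n. \<Sum>l<N. W $$ (i, l) * ((B ^\<^sub>m n) $$ (l, j) / fact n))"
    by (simp add: mult_mat_entry[of _ N N _ N] sum_divide_distrib)
  also have "\<dots> = (\<Sum>l<N. W $$ (i, l) * (\<Sum>n. (B ^\<^sub>m n) $$ (l, j) / fact n))"
    by (subst suminf_sum) (auto intro!: sum.cong suminf_mult sB summable_mult simp del: times_divide_eq_right)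
  also have "\<dots> = (W * mat_exp B) $$ (i, j)"
    by (simp add: mult_mat_entry[of _ N N _ N] mat_exp_entry[of _ N])
  finally show "(mat_exp A * W) $$ (i, j) = (W * mat_exp B) $$ (i, j)" .
qed (simp_all add: carrier_matD[OF mat_exp_carrier, of _ N] carrier_matD[OF assms(3)])

text \<open>Binomial theorem by Pascal's rule, read off at one entry so that all sums are sums of
  scalars. Commutativity lets a new factor \<open>A\<close> pass the powers of
  \<open>B\<close>.\<close>

lemma pow_mat_add_commuting:
  fixes A B :: "'a :: comm_semiring_1 Matrix.mat"
  assumes [simp]: "A \<in> carrier_mat N N" "B \<in> carrier_mat N N"
    and AB: "A * B = B * A" and ij: "i < N" "j < N"
  shows "((A + B) ^\<^sub>m n) $$ (i, j) = (\<Sum>m\<le>n. of_nat (n choose m) * (A ^\<^sub>m m * B ^\<^sub>m (n - m)) $$ (i, j))"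
  using ij
proof (induction n arbitrary: i j)
  case 0
  then show ?case by (auto simp: carrier_matD[OF assms(1)] carrier_matD[OF assms(2)])
next
  case (Suc n)
  define g where "g m k = (A ^\<^sub>m m * B ^\<^sub>m k) $$ (i, j)" for m k
  have carr: "A ^\<^sub>m m * B ^\<^sub>m k \<in> carrier_mat N N" for m k
    by (rule mult_carrier_mat[of _ N N]) auto
  have gA: "(\<Sum>l<N. (A ^\<^sub>m m * B ^\<^sub>m k) $$ (i, l) * A $$ (l, j)) = g (Suc m) k" for m k
  proof -
    have "A ^\<^sub>m m * B ^\<^sub>m k * A = A ^\<^sub>m m * (A * B ^\<^sub>m k)"
      using pow_mat_intertwine[of B N B A k] AB by (simp add: assoc_mult_mat[of _ N N _ N _ N])
    then have "A ^\<^sub>m m * B ^\<^sub>m k * A = A ^\<^sub>m Suc m * B ^\<^sub>m k"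
      by (simp add: assoc_mult_mat[of _ N N _ N _ N])
    then show ?thesis
      using Suc.prems by (simp add: g_def mult_mat_entry[OF carr assms(1), symmetric] del: pow_mat.simps)
  qed
  have gB: "(\<Sum>l<N. (A ^\<^sub>m m * B ^\<^sub>m k) $$ (i, l) * B $$ (l, j)) = g m (Suc k)" for m k
  proof -
    have "A ^\<^sub>m m * B ^\<^sub>m k * B = A ^\<^sub>m m * B ^\<^sub>m Suc k"
      by (simp add: assoc_mult_mat[of _ N N _ N _ N])
    then show ?thesis
      using Suc.prems by (simp add: g_def mult_mat_entry[OF carr assms(2), symmetric] del: pow_mat.simps)
  qed
  have "((A + B) ^\<^sub>m Suc n) $$ (i, j) = (\<Sum>l<N. ((A + B) ^\<^sub>m n) $$ (i, l) * (A + B) $$ (l, j))"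
    using mult_mat_entry[of "(A + B) ^\<^sub>m n" N N "A + B" N i j] Suc.prems by simp
  also have "\<dots> = (\<Sum>l<N. (\<Sum>m\<le>n. of_nat (n choose m) * (A ^\<^sub>m m * B ^\<^sub>m (n - m)) $$ (i, l))
      * (A $$ (l, j) + B $$ (l, j)))"
    using Suc by (intro sum.cong) (auto simp: carrier_matD[OF assms(1)] carrier_matD[OF assms(2)])
  also have "\<dots> = (\<Sum>m\<le>n. of_nat (n choose m) * (\<Sum>l<N. (A ^\<^sub>m m * B ^\<^sub>m (n - m)) $$ (i, l)
      * (A $$ (l, j) + B $$ (l, j))))"
    by (simp add: sum_distrib_left sum_distrib_right mult.assoc) (rule sum.swap)
  also have "\<dots> = (\<Sum>m\<le>n. of_nat (n choose m) * (g (Suc m) (n - m) + g m (Suc (n - m))))"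
    by (simp add: distrib_left sum.distrib gA gB)
  also have "\<dots> = (\<Sum>m\<le>n. of_nat (n choose m) * g (Suc m) (n - m))
      + (\<Sum>m\<le>n. of_nat (n choose m) * g m (Suc n - m))"
    by (simp add: distrib_left sum.distrib Suc_diff_le)
  \<comment> \<open>The added term is zero because \<open>n choose Suc n\<close> is; with it the
    index can be shifted by one, to line up with the other sum for Pascal's rule.\<close>
  also have "(\<Sum>m\<le>n. of_nat (n choose m) * g m (Suc n - m))
      = (\<Sum>m\<le>Suc n. of_nat (n choose m) * g m (Suc n - m))"
    by (simp add: binomial_eq_0)
  also have "\<dots> = g 0 (Suc n) + (\<Sum>m\<le>n. of_nat (n choose Suc m) * g (Suc m) (n - m))"
    by (subst sum.atMost_Suc_shift) simp
  also have "(\<Sum>m\<le>n. of_nat (n choose m) * g (Suc m) (n - m)) + \<dots>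
      = g 0 (Suc n) + (\<Sum>m\<le>n. of_nat (Suc n choose Suc m) * g (Suc m) (n - m))"
    by (simp add: sum.distrib algebra_simps)
  also have "\<dots> = (\<Sum>m\<le>Suc n. of_nat (Suc n choose m) * g m (Suc n - m))"
    by (subst sum.atMost_Suc_shift) simp
  finally show ?case by (simp add: g_def)
qed

text \<open>For each middle index \<open>l\<close> of the matrix product there is a Cauchy product
  of two absolutely convergent series; summed over \<open>l\<close>, these give the binomial
  expansion of the powers of \<open>A + B\<close>.\<close>

lemma mat_exp_add_commuting:
  assumes [simp]: "A \<in> carrier_mat N N" "B \<in> carrier_mat N N" and AB: "A * B = B * A"
  shows "mat_exp (A + B) = mat_exp A * mat_exp B"
proof (rule eq_matI)
  fix i j assume "i < dim_row (mat_exp A * mat_exp B)" "j < dim_col (mat_exp A * mat_exp B)"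
  then have ij [simp]: "i < N" "j < N"
    by (simp_all add: carrier_matD[OF mat_exp_carrier, of _ N])
  let ?a = "\<lambda>l n. (A ^\<^sub>m n) $$ (i, l) / fact n" and ?b = "\<lambda>l n. (B ^\<^sub>m n) $$ (l, j) / fact n"
  have "(mat_exp A * mat_exp B) $$ (i, j) = (\<Sum>l<N. (\<Sum>n. ?a l n) * (\<Sum>n. ?b l n))"
    by (simp add: mult_mat_entry[of _ N N _ N] mat_exp_entry[of _ N])
  also have "\<dots> = (\<Sum>l<N. \<Sum>n. \<Sum>m\<le>n. ?a l m * ?b l (n - m))"
    by (intro sum.cong Cauchy_product summable_mat_exp_entry) auto
  also have "\<dots> = (\<Sum>n. \<Sum>l<N. \<Sum>m\<le>n. ?a l m * ?b l (n - m))"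
    by (intro suminf_sum[symmetric] summable_Cauchy_product summable_mat_exp_entry) auto
  also have "\<dots> = (\<Sum>n. ((A + B) ^\<^sub>m n) $$ (i, j) / fact n)"
  proof (intro arg_cong[where f = suminf] ext)
    fix n
    have "(\<Sum>l<N. \<Sum>m\<le>n. ?a l m * ?b l (n - m))
        = (\<Sum>m\<le>n. (A ^\<^sub>m m * B ^\<^sub>m (n - m)) $$ (i, j) / (fact m * fact (n - m)))"
      by (subst sum.swap) (simp add: mult_mat_entry[of _ N N _ N] sum_divide_distrib)
    also have "\<dots> = (\<Sum>m\<le>n. of_nat (n choose m) * (A ^\<^sub>m m * B ^\<^sub>m (n - m)) $$ (i, j) / fact n)"
      by (intro sum.cong) (auto simp: binomial_fact)
    also have "\<dots> = ((A + B) ^\<^sub>m n) $$ (i, j) / fact n"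
      by (simp add: pow_mat_add_commuting[OF assms] sum_divide_distrib)
    finally show "(\<Sum>l<N. \<Sum>m\<le>n. ?a l m * ?b l (n - m)) = ((A + B) ^\<^sub>m n) $$ (i, j) / fact n" .
  qed
  finally show "mat_exp (A + B) $$ (i, j) = (mat_exp A * mat_exp B) $$ (i, j)"
    by (simp add: mat_exp_entry[of "A + B" N])
qed (simp_all add: carrier_matD[OF mat_exp_carrier, of _ N])

lemma mat_exp_smult_one: "mat_exp (c \<cdot>\<^sub>m 1\<^sub>m N) = exp c \<cdot>\<^sub>m 1\<^sub>m N"
proof (rule eq_matI)
  have pow: "(c \<cdot>\<^sub>m 1\<^sub>m N) ^\<^sub>m n = c ^ n \<cdot>\<^sub>m 1\<^sub>m N" for n
    by (induction n) (auto simp: mult.commute)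
  fix i j assume "i < dim_row (exp c \<cdot>\<^sub>m 1\<^sub>m N)" "j < dim_col (exp c \<cdot>\<^sub>m 1\<^sub>m N)"
  then have [simp]: "i < N" "j < N" by auto
  show "mat_exp (c \<cdot>\<^sub>m 1\<^sub>m N) $$ (i, j) = (exp c \<cdot>\<^sub>m 1\<^sub>m N) $$ (i, j)"
    by (simp add: mat_exp_entry[of _ N] pow exp_def scaleR_conv_of_real divide_inverse mult.commute)
qed (simp_all add: mat_exp_def)

lemma mat_exp_uminus:
  assumes [simp]: "A \<in> carrier_mat N N"
  shows "mat_exp A * mat_exp (- A) = 1\<^sub>m N"
proof -
  have "A * (- A) = (- A) * A"
    by (simp add: uminus_mult_left_mat[of A A] uminus_mult_right_mat[of A A] carrier_matD[OF assms])
  then have "mat_exp A * mat_exp (- A) = mat_exp (A + (- A))"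
    using mat_exp_add_commuting[of A N "- A"] by simp
  \<comment> \<open>Zero is written as a scalar matrix so that \<open>mat_exp_smult_one\<close>
    evaluates its exponential.\<close>
  also have "A + (- A) = 0 \<cdot>\<^sub>m 1\<^sub>m N"
    by (rule eq_matI) (auto simp: carrier_matD[OF assms])
  finally show ?thesis by (simp only: mat_exp_smult_one) auto
qed

section \<open>Adjoints of products, powers and exponentials\<close>

lemma mat_adjoint_dim [simp]: "dim_row (mat_adjoint A) = dim_col A" "dim_col (mat_adjoint A) = dim_row A"
  by (simp_all add: mat_adjoint_def)

lemma mat_adjoint_carrier [simp]: "A \<in> carrier_mat n m \<Longrightarrow> mat_adjoint A \<in> carrier_mat m n"
  by (intro carrier_matI) auto

lemma mat_adjoint_entry [simp]:
  "i < dim_col A \<Longrightarrow> j < dim_row A \<Longrightarrow> mat_adjoint A $$ (i, j) = conjugate (A $$ (j, i))"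
  by (simp add: mat_adjoint_def mat_of_rows_def)

lemma mat_adjoint_mult:
  fixes A B :: "complex Matrix.mat"
  assumes "A \<in> carrier_mat n m" "B \<in> carrier_mat m r"
  shows "mat_adjoint (A * B) = mat_adjoint B * mat_adjoint A"
proof (rule eq_matI)
  note [simp] = carrier_matD[OF assms(1)] carrier_matD[OF assms(2)]
  fix i j assume "i < dim_row (mat_adjoint B * mat_adjoint A)" "j < dim_col (mat_adjoint B * mat_adjoint A)"
  then have ij: "i < r" "j < n" by auto
  then show "mat_adjoint (A * B) $$ (i, j) = (mat_adjoint B * mat_adjoint A) $$ (i, j)"
    using assms mult_mat_entry[of A n m B r j i] mult_mat_entry[of "mat_adjoint B" r m "mat_adjoint A" n i j]
    by (simp add: mult.commute)
qed (use assms in auto)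

text \<open>The adjoint reverses the order of factors, which is harmless here because a matrix
  commutes with its own powers.\<close>

lemma mat_adjoint_pow:
  fixes A :: "complex Matrix.mat"
  assumes [simp]: "A \<in> carrier_mat N N"
  shows "mat_adjoint (A ^\<^sub>m n) = mat_adjoint A ^\<^sub>m n"
proof (induction n)
  case 0
  show ?case by (rule eq_matI) (auto simp: carrier_matD[OF assms])
next
  case (Suc n)
  have "mat_adjoint A * mat_adjoint A ^\<^sub>m n = mat_adjoint A ^\<^sub>m n * mat_adjoint A"
    using pow_mat_intertwine[of "mat_adjoint A" N "mat_adjoint A" "mat_adjoint A" n] by simp
  then show ?case using Suc by (simp add: mat_adjoint_mult[of _ N N _ N])
qed

lemma mat_adjoint_mat_exp:
  assumes [simp]: "A \<in> carrier_mat N N"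
  shows "mat_adjoint (mat_exp A) = mat_exp (mat_adjoint A)"
proof (rule eq_matI)
  fix i j assume "i < dim_row (mat_exp (mat_adjoint A))" "j < dim_col (mat_exp (mat_adjoint A))"
  then have ij [simp]: "i < N" "j < N"
    by (simp_all add: mat_exp_def carrier_matD[OF assms])
  have "mat_exp (mat_adjoint A) $$ (i, j) = (\<Sum>n. cnj ((A ^\<^sub>m n) $$ (j, i) / fact n))"
    by (simp add: mat_exp_entry[of _ N] mat_adjoint_pow[of A N, symmetric] carrier_matD[OF assms])
  also have "\<dots> = cnj (\<Sum>n. (A ^\<^sub>m n) $$ (j, i) / fact n)"
    using summable_norm_cancel[OF summable_mat_exp_entry[OF assms ij(2,1)]]
    by (intro sums_unique[symmetric]) (simp only: sums_cnj summable_sums)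
  finally show "mat_adjoint (mat_exp A) $$ (i, j) = mat_exp (mat_adjoint A) $$ (i, j)"
    by (simp add: carrier_matD[OF mat_exp_carrier, of _ N] mat_exp_entry[of _ N])
qed (simp_all add: mat_exp_def carrier_matD[OF assms])

section \<open>Fermionic modes in the occupation number basis\<close>

lemma set_bit_less_pow2:
  assumes "p < K" "n < 2 ^ K"
  shows "set_bit p n < (2 ^ K :: nat)"
  using assms take_bit_set_bit_eq[of K p n] by (simp flip: take_bit_nat_eq_self_iff)

lemma unset_bit_less_pow2:
  assumes "n < 2 ^ K"
  shows "unset_bit p n < (2 ^ K :: nat)"
proof -
  have "take_bit K n = n"
    using assms by (simp add: take_bit_nat_eq_self_iff)
  then have "take_bit K (unset_bit p n) = unset_bit p n"
    by (intro bit_eqI) (metis bit_take_bit_iff bit_unset_bit_iff)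
  then show ?thesis by (simp add: take_bit_nat_eq_self_iff)
qed

text \<open>Filling and emptying mode \<open>p\<close> are mutually inverse partial maps. This is
  why the creation matrix is the transpose of the annihilation matrix.\<close>

lemma set_bit_eq_iff_unset_bit_eq:
  "\<not> bit n p \<and> m = set_bit p n \<longleftrightarrow> bit m p \<and> n = unset_bit p (m :: nat)"
  unfolding bit_eq_iff[of m "set_bit p n"] bit_eq_iff[of n "unset_bit p m"]
  by (auto simp: bit_set_bit_iff bit_unset_bit_iff)

text \<open>Filling a mode affects the count only for modes to its right; this asymmetry is the
  origin of the anticommutation signs.\<close>

lemma occ_left_set_bit:
  "occ_left p (set_bit q n) = occ_left p n + of_bool (q < p \<and> \<not> bit n q)"
proof -
  have "occ_left p (set_bit q n) = (\<Sum>r<p. of_bool (bit n r) + (if r = q then of_bool (\<not> bit n q) else 0))"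
    unfolding occ_left_def by (intro sum.cong) (auto simp: bit_set_bit_iff)
  also have "\<dots> = occ_left p n + of_bool (q < p \<and> \<not> bit n q)"
    by (auto simp: occ_left_def sum.distrib sum.delta)
  finally show ?thesis .
qed

lemma occ_left_unset_bit:
  assumes "bit n q"
  shows "occ_left p n = occ_left p (unset_bit q n) + of_bool (q < p)"
proof -
  have "set_bit q (unset_bit q n) = n"
    using assms set_bit_eq_iff_unset_bit_eq by metis
  then show ?thesis
    using occ_left_set_bit[of p q "unset_bit q n"] by (simp add: bit_unset_bit_iff)
qed

section \<open>Action of the operators on coefficient functions\<close>

text \<open>A vector is represented by its coefficients \<open>f n\<close>. The coefficient at \<open>n\<close> of its image under
  the annihilation operator comes from the basis vector in which mode \<open>p\<close> is also occupied.\<close>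

definition lower :: "nat \<Rightarrow> (nat \<Rightarrow> complex) \<Rightarrow> nat \<Rightarrow> complex" where
  "lower p f n = (if bit n p then 0 else (-1) ^ occ_left p n * f (set_bit p n))"

definition raise :: "nat \<Rightarrow> (nat \<Rightarrow> complex) \<Rightarrow> nat \<Rightarrow> complex" where
  "raise p f n = (if bit n p then (-1) ^ occ_left p n * f (unset_bit p n) else 0)"

lemma set_bit_commute: "set_bit p (set_bit q n) = set_bit q (set_bit p (n :: nat))"
  and set_bit_unset_bit_commute: "p \<noteq> q \<Longrightarrow> set_bit p (unset_bit q n) = unset_bit q (set_bit p (n :: nat))"
  and set_bit_unset_bit_same: "bit n p \<Longrightarrow> set_bit p (unset_bit p n) = n"
  and unset_bit_set_bit_same: "\<not> bit n p \<Longrightarrow> unset_bit p (set_bit p n) = n"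
  by (rule bit_eqI; auto simp: bit_set_bit_iff bit_unset_bit_iff)+

text \<open>Both orders read the coefficient of the same basis vector. Filling the mode further left
  flips the sign factor of the other mode, but not conversely, so the two orders differ by one
  sign.\<close>

lemma lower_lower_anticommute:
  assumes "p \<noteq> q"
  shows "lower p (lower q f) n = - lower q (lower p f) n"
  using assms by (cases "p < q") (auto simp: lower_def bit_set_bit_iff occ_left_set_bit set_bit_commute)

lemma raise_lower_anticommute:
  assumes "p \<noteq> q"
  shows "raise p (lower q f) n = - lower q (raise p f) n"
  using assms occ_left_unset_bit[of n p q]
  by (cases "p < q") (auto simp: lower_def raise_def bit_set_bit_iff bit_unset_bit_iff occ_left_set_bit
      set_bit_unset_bit_commute)

lemma lower_uminus: "lower p (\<lambda>n. - f n) n = - lower p f n"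
  and raise_uminus: "raise p (\<lambda>n. - f n) n = - raise p f n"
  by (simp_all add: lower_def raise_def)

lemma occ_left_set_bit_same [simp]: "occ_left p (set_bit p n) = occ_left p n"
  by (simp add: occ_left_set_bit)

lemma occ_left_unset_bit_same [simp]: "occ_left p (unset_bit p n) = occ_left p n"
  by (cases "bit n p") (auto simp: occ_left_def bit_unset_bit_iff intro!: sum.cong)

text \<open>The sign occurs squared, since \<open>occ_left p\<close> does not count bit
  \<open>p\<close> itself. What remains are the projections onto mode \<open>p\<close> being empty
  or occupied.\<close>

lemma lower_raise: "lower p (raise p f) = (\<lambda>n. if bit n p then 0 else f n)"
  and raise_lower: "raise p (lower p f) = (\<lambda>n. if bit n p then f n else 0)"
  by (auto simp: lower_def raise_def bit_set_bit_iff bit_unset_bit_iff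
      unset_bit_set_bit_same set_bit_unset_bit_same)

text \<open>Here \<open>p\<close> will be the mode of \<open>k\<close> with spin up and
  \<open>q\<close> that of \<open>-k\<close> with spin down. \<open>pair_raise\<close> takes the
  opposite order, as the adjoint requires.\<close>

definition pair_lower :: "nat \<Rightarrow> nat \<Rightarrow> (nat \<Rightarrow> complex) \<Rightarrow> nat \<Rightarrow> complex" where
  "pair_lower p q f = lower q (lower p f)"

definition pair_raise :: "nat \<Rightarrow> nat \<Rightarrow> (nat \<Rightarrow> complex) \<Rightarrow> nat \<Rightarrow> complex" where
  "pair_raise p q f = raise p (raise q f)"

text \<open>Moving one pair past the other takes four anticommutations, whose signs cancel.\<close>

lemma pair_lower_commute:
  assumes "{p, q} \<inter> {p', q'} = {}"
  shows "pair_lower p q (pair_lower p' q' f) = pair_lower p' q' (pair_lower p q f)"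
proof -
  have ac: "lower r (lower s g) = (\<lambda>n. - lower s (lower r g) n)" if "r \<in> {p, q}" "s \<in> {p', q'}" for r s g
    using assms that by (auto intro: lower_lower_anticommute)
  show ?thesis by (simp add: pair_lower_def ac lower_uminus)
qed

lemma pair_raise_lower_commute:
  assumes "{p, q} \<inter> {p', q'} = {}"
  shows "pair_raise p q (pair_lower p' q' f) = pair_lower p' q' (pair_raise p q f)"
proof -
  have ac: "raise r (lower s g) = (\<lambda>n. - lower s (raise r g) n)" if "r \<in> {p, q}" "s \<in> {p', q'}" for r s g
    using assms that by (auto intro: raise_lower_anticommute)
  show ?thesis by (simp add: pair_lower_def pair_raise_def ac lower_uminus raise_uminus)
qed

lemma pair_lower_pair_lower: "pair_lower p q (pair_lower p q f) = (\<lambda>n. 0)"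
  by (auto simp: pair_lower_def lower_def bit_set_bit_iff)

text \<open>The inner factors collapse to projections that hold already: the outermost lowering
  reads only labels with \<open>q\<close> occupied, and the innermost one gives nonzero values only
  at labels with \<open>p\<close> empty.\<close>

lemma pair_lower_raise_lower:
  "p \<noteq> q \<Longrightarrow> pair_lower p q (pair_raise p q (pair_lower p q f)) = pair_lower p q f"
  unfolding pair_lower_def pair_raise_def lower_raise raise_lower
  by (auto simp: lower_def bit_set_bit_iff)

text \<open>Lowering reads coefficients at labels with some bit set, never at the label 0.\<close>

lemma pair_lower_vacuum: "pair_lower p q (\<lambda>n. if n = 0 then 1 else 0) = (\<lambda>n. 0)"
proof -
  have nonzero: "set_bit r n \<noteq> 0" for r n :: nat
    by (metis bit_0_eq bit_set_bit_iff bot_apply bot_bool_def possible_bit_nat)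
  show ?thesis by (intro ext) (simp add: pair_lower_def lower_def nonzero)
qed

lemma pair_lower_raise:
  "p \<noteq> q \<Longrightarrow> pair_lower p q (pair_raise p q f) = (\<lambda>n. if bit n p \<or> bit n q then 0 else f n)"
  unfolding pair_lower_def pair_raise_def lower_raise
  by (intro ext) (auto simp: lower_def raise_def bit_set_bit_iff unset_bit_set_bit_same)

lemma pair_lower_raise_vacuum:
  "p \<noteq> q \<Longrightarrow> pair_lower p q (pair_raise p q (\<lambda>n. if n = 0 then 1 else 0)) = (\<lambda>n. if n = 0 then 1 else 0)"
  by (auto simp: pair_lower_raise)

text \<open>This transfers identities between coefficient functions to identities between operators;
  an indicator function picks out a column.\<close>

lemma mat_eqI_vec:
  fixes A B :: "'a :: comm_semiring_1 Matrix.mat"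
  assumes A: "A \<in> carrier_mat n m" and B: "B \<in> carrier_mat n m"
    and eq: "\<And>f. A *\<^sub>v Matrix.vec m f = B *\<^sub>v Matrix.vec m f"
  shows "A = B"
proof (rule eq_matI)
  fix i j assume ij: "i < dim_row B" "j < dim_col B"
  have "C $$ (i, j) = (C *\<^sub>v Matrix.vec m (\<lambda>l. if l = j then 1 else 0)) $ i"
    if "C \<in> carrier_mat n m" for C :: "'a Matrix.mat"
    using ij B by (simp add: mult_mat_vec_entry[OF that] if_distrib[of "\<lambda>x. _ * x"] sum.delta
        del: index_mult_mat_vec cong: if_cong)
  from this[OF A] this[OF B] show "A $$ (i, j) = B $$ (i, j)" by (simp add: eq)
qed (use A B in auto)

section \<open>Matrices of the annihilation and creation operators\<close>

lemma annih_carrier [simp]: "annih ks k \<sigma> \<in> carrier_mat (fock_dim ks) (fock_dim ks)"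
  by (simp add: annih_def Let_def mat_of_cols_def)

lemma creat_carrier [simp]: "creat ks k \<sigma> \<in> carrier_mat (fock_dim ks) (fock_dim ks)"
  by (simp add: creat_def Let_def mat_of_cols_def)

lemma annih_entry:
  assumes "i < fock_dim ks" "j < fock_dim ks"
  shows "annih ks k \<sigma> $$ (i, j) = (if bit j (mode ks k \<sigma>) \<and> i = unset_bit (mode ks k \<sigma>) j
    then (-1) ^ occ_left (mode ks k \<sigma>) j else 0)"
proof -
  have "unset_bit (mode ks k \<sigma>) j < fock_dim ks"
    using assms unset_bit_less_pow2 by (simp add: fock_dim_def)
  then show ?thesis using assms by (auto simp: annih_def Let_def mat_of_cols_index)
qed

lemma creat_entry:
  assumes "i < fock_dim ks" "j < fock_dim ks" "mode ks k \<sigma> < 2 * length ks"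
  shows "creat ks k \<sigma> $$ (i, j) = (if \<not> bit j (mode ks k \<sigma>) \<and> i = set_bit (mode ks k \<sigma>) j
    then (-1) ^ occ_left (mode ks k \<sigma>) j else 0)"
proof -
  have "set_bit (mode ks k \<sigma>) j < fock_dim ks"
    using assms set_bit_less_pow2 by (simp add: fock_dim_def)
  then show ?thesis using assms by (auto simp: creat_def Let_def mat_of_cols_index)
qed

lemma creat_eq_adjoint_annih:
  assumes "mode ks k \<sigma> < 2 * length ks"
  shows "creat ks k \<sigma> = mat_adjoint (annih ks k \<sigma>)"
proof (rule eq_matI)
  note [simp] = carrier_matD[OF annih_carrier] carrier_matD[OF creat_carrier]
  fix i j assume "i < dim_row (mat_adjoint (annih ks k \<sigma>))" "j < dim_col (mat_adjoint (annih ks k \<sigma>))"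
  then have ij: "i < fock_dim ks" "j < fock_dim ks" by auto
  show "creat ks k \<sigma> $$ (i, j) = mat_adjoint (annih ks k \<sigma>) $$ (i, j)"
    using ij set_bit_eq_iff_unset_bit_eq[of j "mode ks k \<sigma>" i]
    by (auto simp: creat_entry assms annih_entry)
qed (simp_all add: carrier_matD[OF annih_carrier] carrier_matD[OF creat_carrier])

lemma annih_mult_vec:
  assumes "mode ks k \<sigma> < 2 * length ks"
  shows "annih ks k \<sigma> *\<^sub>v Matrix.vec (fock_dim ks) f = Matrix.vec (fock_dim ks) (lower (mode ks k \<sigma>) f)"
proof (rule eq_vecI)
  let ?N = "fock_dim ks" and ?p = "mode ks k \<sigma>"
  fix i assume "i < dim_vec (Matrix.vec ?N (lower ?p f))"
  then have i: "i < ?N" by simp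
  have less: "set_bit ?p i < ?N"
    using i assms set_bit_less_pow2 by (simp add: fock_dim_def)
  have "(annih ks k \<sigma> *\<^sub>v Matrix.vec ?N f) $ i = (\<Sum>l<?N. annih ks k \<sigma> $$ (i, l) * f l)"
    using i by (simp add: mult_mat_vec_entry[OF annih_carrier])
  \<comment> \<open>Row \<open>i\<close> has at most one nonzero entry, in column
    \<open>set_bit ?p i\<close>. If the mode is occupied in \<open>i\<close>, that column is
    \<open>i\<close> itself, and both the entry and \<open>lower\<close> vanish.\<close>
  also have "\<dots> = (\<Sum>l<?N. if l = set_bit ?p i then lower ?p f i else 0)"
    using i set_bit_eq_iff_unset_bit_eq[of i ?p]
    by (intro sum.cong) (auto simp: annih_entry lower_def bit_set_bit_iff)
  finally show "(annih ks k \<sigma> *\<^sub>v Matrix.vec ?N f) $ i = Matrix.vec ?N (lower ?p f) $ i"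
    using i less by simp
qed (simp add: carrier_matD[OF annih_carrier])

lemma creat_mult_vec:
  assumes "mode ks k \<sigma> < 2 * length ks"
  shows "creat ks k \<sigma> *\<^sub>v Matrix.vec (fock_dim ks) f = Matrix.vec (fock_dim ks) (raise (mode ks k \<sigma>) f)"
proof (rule eq_vecI)
  let ?N = "fock_dim ks" and ?p = "mode ks k \<sigma>"
  fix i assume "i < dim_vec (Matrix.vec ?N (raise ?p f))"
  then have i: "i < ?N" by simp
  have less: "unset_bit ?p i < ?N"
    using i unset_bit_less_pow2 by (simp add: fock_dim_def)
  have "(creat ks k \<sigma> *\<^sub>v Matrix.vec ?N f) $ i = (\<Sum>l<?N. creat ks k \<sigma> $$ (i, l) * f l)"
    using i by (simp add: mult_mat_vec_entry[OF creat_carrier])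
  also have "\<dots> = (\<Sum>l<?N. if l = unset_bit ?p i then raise ?p f i else 0)"
    using i set_bit_eq_iff_unset_bit_eq[of _ ?p i] assms
    by (intro sum.cong) (auto simp: creat_entry raise_def bit_unset_bit_iff)
  finally show "(creat ks k \<sigma> *\<^sub>v Matrix.vec ?N f) $ i = Matrix.vec ?N (raise ?p f) $ i"
    using i less by simp
qed (simp add: carrier_matD[OF creat_carrier])

section \<open>Rotations generated by commuting pair operators\<close>

lemma mat_adjoint_adjoint [simp]: "mat_adjoint (mat_adjoint A) = (A :: complex Matrix.mat)"
  by (rule eq_matI) auto

section \<open>The inner product, adjoints and finite sums of vectors\<close>

lemma fock_inner_sum:
  assumes "u \<in> carrier_vec N" "v \<in> carrier_vec N"
  shows "fock_inner u v = (\<Sum>i<N. cnj (u $ i) * v $ i)"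
  using assms by (simp add: fock_inner_def scalar_prod_def lessThan_atLeast0 mult.commute)

lemma fock_inner_add_right:
  assumes "u \<in> carrier_vec N" "v \<in> carrier_vec N" "w \<in> carrier_vec N"
  shows "fock_inner u (v + w) = fock_inner u v + fock_inner u w"
  using assms by (simp add: fock_inner_sum[of _ N] distrib_left sum.distrib)

lemma fock_inner_add_left:
  assumes "u \<in> carrier_vec N" "v \<in> carrier_vec N" "w \<in> carrier_vec N"
  shows "fock_inner (v + w) u = fock_inner v u + fock_inner w u"
  using assms by (simp add: fock_inner_sum[of _ N] distrib_right sum.distrib)

lemma fock_inner_smult_right:
  assumes "u \<in> carrier_vec N" "v \<in> carrier_vec N"
  shows "fock_inner u (c \<cdot>\<^sub>v v) = c * fock_inner u v"
  using assms by (simp add: fock_inner_sum[of _ N] sum_distrib_left mult.left_commute)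

lemma fock_inner_smult_left:
  assumes "u \<in> carrier_vec N" "v \<in> carrier_vec N"
  shows "fock_inner (c \<cdot>\<^sub>v u) v = cnj c * fock_inner u v"
  using assms by (simp add: fock_inner_sum[of _ N] sum_distrib_left mult.assoc)

lemma fock_inner_cnj:
  assumes "u \<in> carrier_vec N" "v \<in> carrier_vec N"
  shows "cnj (fock_inner u v) = fock_inner v u"
  using assms by (simp add: fock_inner_sum[of _ N] mult.commute)

lemma fock_inner_zero_right [simp]: "u \<in> carrier_vec N \<Longrightarrow> fock_inner u (0\<^sub>v N) = 0"
  and fock_inner_zero_left [simp]: "u \<in> carrier_vec N \<Longrightarrow> fock_inner (0\<^sub>v N) u = 0"
  by (simp_all add: fock_inner_sum[of _ N])

lemma fock_inner_adjoint:
  assumes A: "A \<in> carrier_mat N N" and u: "u \<in> carrier_vec N" and v: "v \<in> carrier_vec N"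
  shows "fock_inner u (A *\<^sub>v v) = fock_inner (mat_adjoint A *\<^sub>v u) v"
proof -
  have "fock_inner u (A *\<^sub>v v) = (\<Sum>i<N. \<Sum>l<N. cnj (u $ i) * (A $$ (i, l) * v $ l))"
    using assms by (simp add: fock_inner_sum[of _ N] mult_mat_vec_entry[OF A v] sum_distrib_left
        del: index_mult_mat_vec)
  also have "\<dots> = (\<Sum>l<N. \<Sum>i<N. cnj (u $ i) * (A $$ (i, l) * v $ l))"
    by (rule sum.swap)
  also have "\<dots> = fock_inner (mat_adjoint A *\<^sub>v u) v"
    using assms mult_mat_vec_carrier[OF mat_adjoint_carrier[OF A] u]
    by (simp add: fock_inner_sum[of _ N] mult_mat_vec_entry[OF mat_adjoint_carrier[OF A] u]
        carrier_matD[OF A] sum_distrib_left mult_ac del: index_mult_mat_vec)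
  finally show ?thesis .
qed

lemma fock_inner_finsum_right:
  assumes "finite F" "u \<in> carrier_vec N" "\<And>x. x \<in> F \<Longrightarrow> f x \<in> carrier_vec N"
  shows "fock_inner u (finsum_vec TYPE(complex) N f F) = (\<Sum>x\<in>F. fock_inner u (f x))"
proof -
  have f: "f \<in> F \<rightarrow> carrier_vec N" using assms by auto
  have "fock_inner u (finsum_vec TYPE(complex) N f F) = (\<Sum>i<N. \<Sum>x\<in>F. cnj (u $ i) * f x $ i)"
    using assms f by (simp add: fock_inner_sum[of _ N] finsum_vec_closed index_finsum_vec sum_distrib_left)
  also have "\<dots> = (\<Sum>x\<in>F. fock_inner u (f x))"
    using assms by (subst sum.swap) (simp add: fock_inner_sum[of _ N])
  finally show ?thesis .
qed

lemma fock_inner_finsum_left: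
  assumes "finite F" "u \<in> carrier_vec N" "\<And>x. x \<in> F \<Longrightarrow> f x \<in> carrier_vec N"
  shows "fock_inner (finsum_vec TYPE(complex) N f F) u = (\<Sum>x\<in>F. fock_inner (f x) u)"
proof -
  have f: "finsum_vec TYPE(complex) N f F \<in> carrier_vec N" using assms by (intro finsum_vec_closed) auto
  have "fock_inner (finsum_vec TYPE(complex) N f F) u = cnj (\<Sum>x\<in>F. fock_inner u (f x))"
    using fock_inner_cnj[OF assms(2) f] fock_inner_finsum_right[OF assms] by simp
  then show ?thesis using assms by (simp add: fock_inner_cnj[of _ N])
qed

lemma mult_mat_vec_finsum:
  assumes A: "A \<in> carrier_mat N N" and "finite F" "\<And>x. x \<in> F \<Longrightarrow> f x \<in> carrier_vec N"
  shows "A *\<^sub>v finsum_vec TYPE(complex) N f F = finsum_vec TYPE(complex) N (\<lambda>x. A *\<^sub>v f x) F"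
proof (rule eq_vecI)
  have f: "f \<in> F \<rightarrow> carrier_vec N" "(\<lambda>x. A *\<^sub>v f x) \<in> F \<rightarrow> carrier_vec N"
    using assms by auto
  then have dim [simp]: "dim_vec (finsum_vec TYPE(complex) N (\<lambda>x. A *\<^sub>v f x) F) = N"
    using finsum_vec_closed carrier_vecD by blast
  fix i assume "i < dim_vec (finsum_vec TYPE(complex) N (\<lambda>x. A *\<^sub>v f x) F)"
  then have i: "i < N" by simp
  have "(A *\<^sub>v finsum_vec TYPE(complex) N f F) $ i = (\<Sum>l<N. \<Sum>x\<in>F. A $$ (i, l) * f x $ l)"
    using assms f i by (simp add: mult_mat_vec_entry[OF A] finsum_vec_closed index_finsum_vec sum_distrib_left
        del: index_mult_mat_vec)
  also have "\<dots> = (\<Sum>x\<in>F. (A *\<^sub>v f x) $ i)"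
    using assms i by (subst sum.swap) (simp add: mult_mat_vec_entry[OF A] del: index_mult_mat_vec)
  finally show "(A *\<^sub>v finsum_vec TYPE(complex) N f F) $ i = finsum_vec TYPE(complex) N (\<lambda>x. A *\<^sub>v f x) F $ i"
    using assms f i by (simp add: index_finsum_vec del: index_mult_mat_vec)
qed (use assms finsum_vec_closed[of "\<lambda>x. A *\<^sub>v f x" F N] in \<open>auto dest!: carrier_vecD\<close>)

lemma finsum_vec_cong:
  assumes "\<And>x. x \<in> F \<Longrightarrow> f x = g x" "finite F" "\<And>x. x \<in> F \<Longrightarrow> g x \<in> carrier_vec N"
  shows "finsum_vec TYPE(complex) N f F = finsum_vec TYPE(complex) N g F"
proof (rule eq_vecI)
  have f: "f \<in> F \<rightarrow> carrier_vec N" "g \<in> F \<rightarrow> carrier_vec N" using assms by auto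
  then have [simp]: "dim_vec (finsum_vec TYPE(complex) N f F) = N" "dim_vec (finsum_vec TYPE(complex) N g F) = N"
    using finsum_vec_closed carrier_vecD by blast+
  then show "dim_vec (finsum_vec TYPE(complex) N f F) = dim_vec (finsum_vec TYPE(complex) N g F)" by simp
  fix i assume "i < dim_vec (finsum_vec TYPE(complex) N g F)"
  then show "finsum_vec TYPE(complex) N f F $ i = finsum_vec TYPE(complex) N g F $ i"
    using assms f by (simp add: index_finsum_vec)
qed

section \<open>Finite sums of matrices and conjugation of ladder operators\<close>

abbreviation finsum_mat :: "nat \<Rightarrow> ('k \<Rightarrow> complex Matrix.mat) \<Rightarrow> 'k set \<Rightarrow> complex Matrix.mat" where
  "finsum_mat N \<equiv> finsum (module_mat TYPE(complex) N N)"

lemma finsum_mat_carrier [simp]: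
  assumes "\<And>x. x \<in> F \<Longrightarrow> f x \<in> carrier_mat N N"
  shows "finsum_mat N f F \<in> carrier_mat N N"
proof -
  interpret abelian_group "module_mat TYPE(complex) N N" by (rule abelian_group_mat)
  show ?thesis using finsum_closed[of f F] assms by (auto simp: module_mat_simps)
qed

lemma index_finsum_mat:
  assumes "finite F" "\<And>x. x \<in> F \<Longrightarrow> f x \<in> carrier_mat N N" "i < N" "j < N"
  shows "finsum_mat N f F $$ (i, j) = (\<Sum>x\<in>F. f x $$ (i, j))"
  using assms(1,2)
proof (induction F)
  case empty
  interpret abelian_group "module_mat TYPE(complex) N N" by (rule abelian_group_mat)
  show ?case using assms(3,4) by (simp add: module_mat_simps)
next
  case (insert x F)
  interpret abelian_group "module_mat TYPE(complex) N N" by (rule abelian_group_mat)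
  have "finsum_mat N f (insert x F) = f x + finsum_mat N f F"
    using insert finsum_insert[of F x f] by (auto simp: module_mat_simps)
  moreover have "finsum_mat N f F \<in> carrier_mat N N" using insert by simp
  ultimately show ?case using insert assms(3,4) carrier_matD[of "finsum_mat N f F" N N] by auto
qed

text \<open>Only the summand at \<open>k\<close> fails to commute with \<open>W\<close>, so the
  whole sum inherits its ladder relation. The extra term is absorbed on the right as a scalar
  matrix, the form that \<open>mat_exp_intertwine\<close> can use.\<close>

lemma finsum_mat_commutator:
  assumes "finite F" "k \<in> F" and f: "\<And>x. x \<in> F \<Longrightarrow> f x \<in> carrier_mat N N"
    and W: "W \<in> carrier_mat N N"
    and comm: "\<And>x. x \<in> F \<Longrightarrow> x \<noteq> k \<Longrightarrow> f x * W = W * f x"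
    and ladder: "f k * W = W * f k + c \<cdot>\<^sub>m W"
  shows "finsum_mat N f F * W = W * (finsum_mat N f F + c \<cdot>\<^sub>m 1\<^sub>m N)"
proof (rule eq_matI)
  note FM = finsum_mat_carrier[of F f N, OF f]
  have FM1: "finsum_mat N f F + c \<cdot>\<^sub>m 1\<^sub>m N \<in> carrier_mat N N" using FM by simp
  note [simp] = carrier_matD[OF FM] carrier_matD[OF W]
  fix i j assume "i < dim_row (W * (finsum_mat N f F + c \<cdot>\<^sub>m 1\<^sub>m N))" "j < dim_col (W * (finsum_mat N f F + c \<cdot>\<^sub>m 1\<^sub>m N))"
  then have ij [simp]: "i < N" "j < N" by auto
  have "(finsum_mat N f F * W) $$ (i, j) = (\<Sum>l<N. \<Sum>x\<in>F. f x $$ (i, l) * W $$ (l, j))"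
    by (simp add: mult_mat_entry[OF FM W] index_finsum_mat[OF assms(1) f] sum_distrib_right del: index_mult_mat)
  also have "\<dots> = (\<Sum>x\<in>F. (f x * W) $$ (i, j))"
    by (subst sum.swap) (simp add: mult_mat_entry[OF f W] del: index_mult_mat)
  also have "\<dots> = (\<Sum>x\<in>F. (W * f x) $$ (i, j) + (if x = k then c * W $$ (i, j) else 0))"
    by (intro sum.cong refl) (use comm ladder f W carrier_matD[OF f] in \<open>auto simp del: index_mult_mat(1)\<close>)
  also have "\<dots> = (\<Sum>x\<in>F. \<Sum>l<N. W $$ (i, l) * f x $$ (l, j)) + c * W $$ (i, j)"
    using assms(1,2) by (simp add: sum.distrib mult_mat_entry[OF W f] del: index_mult_mat)
  also have "(\<Sum>x\<in>F. \<Sum>l<N. W $$ (i, l) * f x $$ (l, j)) = (\<Sum>l<N. W $$ (i, l) * finsum_mat N f F $$ (l, j))"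
    by (subst sum.swap) (simp add: index_finsum_mat[OF assms(1) f] sum_distrib_left)
  \<comment> \<open>The scalar multiple is expanded as a row of \<open>W\<close> against a column of
    the scalar matrix, so that both terms merge into one matrix product.\<close>
  also have "c * W $$ (i, j) = (\<Sum>l<N. W $$ (i, l) * (c * (if l = j then 1 else 0)))"
    by (simp add: if_distrib[of "\<lambda>x. _ * x"] sum.delta mult.commute cong: if_cong)
  also have "(\<Sum>l<N. W $$ (i, l) * finsum_mat N f F $$ (l, j)) + \<dots> = (W * (finsum_mat N f F + c \<cdot>\<^sub>m 1\<^sub>m N)) $$ (i, j)"
    by (simp add: mult_mat_entry[OF W FM1] sum.distrib distrib_left del: index_mult_mat)
  finally show "(finsum_mat N f F * W) $$ (i, j) = (W * (finsum_mat N f F + c \<cdot>\<^sub>m 1\<^sub>m N)) $$ (i, j)" .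
qed (use finsum_mat_carrier[of F f N, OF f] W in auto)

text \<open>\<open>W\<close> intertwines \<open>H\<close> with its shift by \<open>c\<close>, and
  the shift leaves the exponential as the number \<open>exp c\<close> because scalar matrices
  commute with \<open>H\<close>.\<close>

lemma mat_exp_conjugate_ladder:
  assumes H: "H \<in> carrier_mat N N" and W: "W \<in> carrier_mat N N"
    and HW: "H * W = W * (H + c \<cdot>\<^sub>m 1\<^sub>m N)"
  shows "mat_exp H * W * mat_exp (- H) = exp c \<cdot>\<^sub>m W"
proof -
  note [simp] = assms
  have "mat_exp (H + c \<cdot>\<^sub>m 1\<^sub>m N) = mat_exp H * mat_exp (c \<cdot>\<^sub>m 1\<^sub>m N)"
    by (rule mat_exp_add_commuting[of _ N]) (auto simp: left_mult_one_mat[OF H] right_mult_one_mat[OF H] mult_smult_distrib[of H N N "1\<^sub>m N" N] mult_smult_assoc_mat[of "1\<^sub>m N" N N H N])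
  also have "\<dots> = exp c \<cdot>\<^sub>m mat_exp H"
    by (simp add: mat_exp_smult_one mult_smult_distrib[of "mat_exp H" N N "1\<^sub>m N" N]
        right_mult_one_mat[of "mat_exp H" N N])
  finally have shift: "mat_exp (H + c \<cdot>\<^sub>m 1\<^sub>m N) = exp c \<cdot>\<^sub>m mat_exp H" .
  have "mat_exp H * W = W * mat_exp (H + c \<cdot>\<^sub>m 1\<^sub>m N)"
    by (rule mat_exp_intertwine[of _ N]) (auto simp: HW)
  also have "\<dots> = exp c \<cdot>\<^sub>m (W * mat_exp H)"
    by (simp add: shift mult_smult_distrib[of W N N "mat_exp H" N])
  finally have "mat_exp H * W * mat_exp (- H) = exp c \<cdot>\<^sub>m (W * mat_exp H * mat_exp (- H))"
    using mult_carrier_mat[of W N N "mat_exp H" N]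
    by (simp add: mult_smult_assoc_mat[of "W * mat_exp H" N N "mat_exp (- H)" N])
  also have "W * mat_exp H * mat_exp (- H) = W"
    by (simp add: assoc_mult_mat[of W N N _ N _ N] mat_exp_uminus[of H N] right_mult_one_mat[OF W])
  finally show ?thesis .
qed

section \<open>The algebra of commuting pair operators\<close>

lemma smult_mat_mult_vec:
  "v \<in> carrier_vec (dim_col A) \<Longrightarrow> (c \<cdot>\<^sub>m A) *\<^sub>v v = c \<cdot>\<^sub>v (A *\<^sub>v (v :: 'a :: comm_semiring_1 Matrix.vec))"
  by (rule eq_vecI) (auto simp: scalar_prod_def sum_distrib_left mult.assoc)

lemma commute_mult_mat:
  assumes "x \<in> carrier_mat N N" "y \<in> carrier_mat N N" "z \<in> carrier_mat N N"
    and "x * y = y * x" "x * z = z * x"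
  shows "x * (y * z) = (y * z) * (x :: 'a :: comm_semiring_1 Matrix.mat)"
proof -
  have "x * (y * z) = y * x * z"
    using assms by (simp flip: assoc_mult_mat[of x N N y N z N])
  also have "\<dots> = y * (z * x)"
    using assms by (simp add: assoc_mult_mat[of y N N x N z N])
  finally show ?thesis
    using assms by (simp add: assoc_mult_mat[of y N N z N x N])
qed

text \<open>The relations of hard-core bosons, separated from the arithmetic of bits. In Fock space
  \<open>b_adjoint_v0\<close> says that both modes of each pair are empty in \<open>v0\<close>;
  \<open>b_v0\<close> alone would allow one of them to be occupied.\<close>

locale commuting_pairs =
  fixes N :: nat and S :: "'k set" and b :: "'k \<Rightarrow> complex Matrix.mat" and v0 :: "complex Matrix.vec"
  assumes finite_S [simp]: "finite S"
    and b_carrier [simp]: "k \<in> S \<Longrightarrow> b k \<in> carrier_mat N N"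
    and v0_carrier [simp]: "v0 \<in> carrier_vec N"
    and b_commute: "k \<in> S \<Longrightarrow> l \<in> S \<Longrightarrow> b k * b l = b l * b k"
    and b_adjoint_commute: "k \<in> S \<Longrightarrow> l \<in> S \<Longrightarrow> k \<noteq> l \<Longrightarrow> mat_adjoint (b k) * b l = b l * mat_adjoint (b k)"
    and b_square: "k \<in> S \<Longrightarrow> b k * b k = 0\<^sub>m N N"
    and b_partial_isometry: "k \<in> S \<Longrightarrow> b k * mat_adjoint (b k) * b k = b k"
    and b_v0: "k \<in> S \<Longrightarrow> b k *\<^sub>v v0 = 0\<^sub>v N"
    and b_adjoint_v0: "k \<in> S \<Longrightarrow> b k *\<^sub>v (mat_adjoint (b k) *\<^sub>v v0) = v0"
    and v0_norm: "fock_inner v0 v0 = 1"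
begin

abbreviation bd :: "'k \<Rightarrow> complex Matrix.mat" where "bd k \<equiv> mat_adjoint (b k)"

text \<open>The analogue of the Pauli matrix for the z-axis: 1 on an empty pair, -1 on a full one
  and, in Fock space, 0 when just one mode is occupied.\<close>

definition pair_z :: "'k \<Rightarrow> complex Matrix.mat" where
  "pair_z k = b k * bd k - bd k * b k"

text \<open>For \<open>s = \<plusminus>1\<close> this is an eigenvector of the commutator with \<open>b k - bd k\<close>, see \<open>ladder_step\<close>.\<close>

definition ladder :: "complex \<Rightarrow> 'k \<Rightarrow> complex Matrix.mat" where
  "ladder s k = b k + bd k + (s * \<i>) \<cdot>\<^sub>m pair_z k"

definition rotation :: "('k \<Rightarrow> real) \<Rightarrow> complex Matrix.mat" where
  "rotation \<theta> = finsum_mat N (\<lambda>k. complex_of_real (\<theta> k) \<cdot>\<^sub>m (b k - bd k)) S"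

lemma carriers [simp]:
  assumes "k \<in> S"
  shows "b k * bd k \<in> carrier_mat N N" "bd k * b k \<in> carrier_mat N N" "pair_z k \<in> carrier_mat N N"
    "ladder s k \<in> carrier_mat N N" "b k - bd k \<in> carrier_mat N N"
proof -
  have *: "l \<in> S \<Longrightarrow> bd l \<in> carrier_mat N N" for l by simp
  show P: "b k * bd k \<in> carrier_mat N N" "bd k * b k \<in> carrier_mat N N"
    using assms * by (auto intro!: mult_carrier_mat[of _ N N])
  show Z: "pair_z k \<in> carrier_mat N N" unfolding pair_z_def by (rule minus_carrier_mat) (fact P)
  then show "ladder s k \<in> carrier_mat N N" using assms by (simp add: ladder_def)
  show "b k - bd k \<in> carrier_mat N N" using assms * by (auto intro!: minus_carrier_mat)
qed

lemma rotation_carrier [simp]: "rotation \<theta> \<in> carrier_mat N N"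
  unfolding rotation_def by (intro finsum_mat_carrier smult_carrier_mat) simp

lemma bd_square: "k \<in> S \<Longrightarrow> bd k * bd k = 0\<^sub>m N N"
  using arg_cong[OF b_square, of k mat_adjoint]
  by (simp add: mat_adjoint_mult[of _ N N _ N] carrier_matD[of _ N N]) (auto intro!: eq_matI)

lemma bd_partial_isometry: "k \<in> S \<Longrightarrow> bd k * b k * bd k = bd k"
  using arg_cong[OF b_partial_isometry, of k mat_adjoint]
  by (simp add: mat_adjoint_mult[of _ N N _ N] assoc_mult_mat[of _ N N _ N _ N])

lemma bd_commute: "k \<in> S \<Longrightarrow> l \<in> S \<Longrightarrow> bd k * bd l = bd l * bd k"
  using arg_cong[OF b_commute, of k l mat_adjoint]
  by (simp add: mat_adjoint_mult[of _ N N _ N])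

lemma ladder_commute:
  assumes "k \<in> S" and x: "x \<in> carrier_mat N N"
    and "x * b k = b k * x" "x * bd k = bd k * x"
  shows "x * ladder s k = ladder s k * x"
proof -
  note [simp] = assms
  have 1: "x * (b k * bd k) = (b k * bd k) * x"
    using assms by (intro commute_mult_mat[of _ N]) auto
  have 2: "x * (bd k * b k) = (bd k * b k) * x"
    using assms by (intro commute_mult_mat[of _ N]) auto
  show ?thesis
    unfolding ladder_def pair_z_def
    by (simp add: mult_add_distrib_mat[of x N N _ N] add_mult_distrib_mat[of _ N N _ x N]
        mult_minus_distrib_mat[of x N N _ N] minus_mult_distrib_mat[of _ N N _ x N]
        mult_smult_distrib[of x N N _ N] mult_smult_assoc_mat[of _ N N x N] minus_carrier_mat 1 2)
qed

lemma minus_commute_b: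
  assumes "k \<in> S" "l \<in> S" "l \<noteq> k"
  shows "(b l - bd l) * b k = b k * (b l - bd l)" "(b l - bd l) * bd k = bd k * (b l - bd l)"
  using assms b_adjoint_commute[of l k] b_adjoint_commute[of k l] b_commute[of k l] bd_commute[of k l]
  by (simp_all add: minus_mult_distrib_mat[of _ N N _ _ N] mult_minus_distrib_mat[of _ N N _ N])

text \<open>Write X for \<open>b k + bd k\<close> and Z for \<open>pair_z k\<close>. Commutation
  with \<open>b k - bd k\<close> sends X to 2Z and Z to -2X, an infinitesimal rotation of their
  plane. Its eigenvectors are X + isZ with eigenvalue -2is, where \<open>s * s = 1\<close> covers
  both signs.\<close>

lemma ladder_step:
  assumes k [simp]: "k \<in> S" and s: "s * s = 1"
  shows "(b k - bd k) * ladder s k = ladder s k * (b k - bd k) + (- 2 * \<i> * s) \<cdot>\<^sub>m ladder s k"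
proof -
  define P Q where "P = b k * bd k" and "Q = bd k * b k"
  have c [simp]: "P \<in> carrier_mat N N" "Q \<in> carrier_mat N N" by (simp_all add: P_def Q_def)
  have Z: "pair_z k = P - Q" by (simp add: pair_z_def P_def Q_def)
  \<comment> \<open>The multiplication table follows from the vanishing squares and the partial
    isometry relation for \<open>b k\<close> and \<open>bd k\<close>.\<close>
  have prods: "b k * bd k = P" "bd k * b k = Q" "b k * P = 0\<^sub>m N N" "b k * Q = b k" "bd k * P = bd k"
    "bd k * Q = 0\<^sub>m N N" "P * b k = b k" "P * bd k = 0\<^sub>m N N" "Q * b k = 0\<^sub>m N N" "Q * bd k = bd k"
    using b_square[OF k] bd_square[OF k] b_partial_isometry[OF k] bd_partial_isometry[OF k]
      assoc_mult_mat[of "b k" N N "b k" N "bd k" N] assoc_mult_mat[of "b k" N N "bd k" N "b k" N]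
      assoc_mult_mat[of "b k" N N "bd k" N "bd k" N] assoc_mult_mat[of "bd k" N N "b k" N "bd k" N]
      assoc_mult_mat[of "bd k" N N "b k" N "b k" N] assoc_mult_mat[of "bd k" N N "bd k" N "b k" N]
      left_mult_zero_mat[of "b k" N N N] left_mult_zero_mat[of "bd k" N N N]
      right_mult_zero_mat[of "b k" N N N] right_mult_zero_mat[of "bd k" N N N]
    by (simp_all add: P_def Q_def)
  have 1: "(b k - bd k) * ladder s k = P - Q + (s * \<i>) \<cdot>\<^sub>m (- b k - bd k)"
    unfolding ladder_def Z
    by (simp add: mult_add_distrib_mat[of _ N N _ N] minus_mult_distrib_mat[of _ N N _ _ N]
        mult_minus_distrib_mat[of _ N N _ N] mult_smult_distrib[of _ N N _ N] prods b_square bd_square minus_carrier_mat)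
      (rule eq_matI; simp add: carrier_matD[OF b_carrier] carrier_matD[OF c(1)] carrier_matD[OF c(2)] algebra_simps)
  have 2: "ladder s k * (b k - bd k) = Q - P + (s * \<i>) \<cdot>\<^sub>m (b k + bd k)"
    unfolding ladder_def Z
    by (simp add: add_mult_distrib_mat[of _ N N _ _ N] minus_mult_distrib_mat[of _ N N _ _ N]
        mult_minus_distrib_mat[of _ N N _ N] mult_smult_assoc_mat[of _ N N _ N] prods b_square bd_square minus_carrier_mat)
      (rule eq_matI; simp add: carrier_matD[OF b_carrier] carrier_matD[OF c(1)] carrier_matD[OF c(2)] algebra_simps)
  have s2: "s * (s * x) = x" for x
    using s by (simp flip: mult.assoc)
  show ?thesis
    unfolding 1 2 unfolding ladder_def Z
    by (rule eq_matI; simp add: carrier_matD[OF b_carrier] carrier_matD[OF c(1)] carrier_matD[OF c(2)]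
        algebra_simps s2)
qed

text \<open>All summands of the generator except the one at \<open>k\<close> commute with the ladder
  operator, so only \<open>\<theta> k\<close> enters the phase.\<close>

lemma rotation_ladder:
  assumes k: "k \<in> S" and s: "s * s = 1"
  shows "mat_exp (rotation \<theta>) * ladder s k * mat_exp (- rotation \<theta>)
    = exp (- 2 * \<i> * s * complex_of_real (\<theta> k)) \<cdot>\<^sub>m ladder s k"
proof (rule mat_exp_conjugate_ladder[of _ N])
  note [simp] = k
  show "rotation \<theta> * ladder s k = ladder s k * (rotation \<theta> + (- 2 * \<i> * s * complex_of_real (\<theta> k)) \<cdot>\<^sub>m 1\<^sub>m N)"
    unfolding rotation_def
  proof (rule finsum_mat_commutator[OF finite_S k])
    fix l assume l: "l \<in> S" "l \<noteq> k"
    show "complex_of_real (\<theta> l) \<cdot>\<^sub>m (b l - bd l) * ladder s k = ladder s k * (complex_of_real (\<theta> l) \<cdot>\<^sub>m (b l - bd l))"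
      using l ladder_commute[OF k _ minus_commute_b[OF k l]]
      by (simp add: mult_smult_distrib[of _ N N _ N] mult_smult_assoc_mat[of _ N N _ N])
  next
    show "complex_of_real (\<theta> k) \<cdot>\<^sub>m (b k - bd k) * ladder s k
      = ladder s k * (complex_of_real (\<theta> k) \<cdot>\<^sub>m (b k - bd k))
        + (- 2 * \<i> * s * complex_of_real (\<theta> k)) \<cdot>\<^sub>m ladder s k"
      by (simp add: mult_smult_distrib[of _ N N _ N] mult_smult_assoc_mat[of _ N N _ N] ladder_step[OF k s])
        (rule eq_matI; simp add: carrier_matD[OF carriers(4)] carrier_matD[OF carriers(5)] carrier_matD[OF b_carrier] algebra_simps
          del: index_mult_mat(1))
  qed auto
qed (use k in auto)

lemma rotation_minus:
  assumes k: "k \<in> S"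
  shows "mat_exp (rotation \<theta>) * (b k - bd k) * mat_exp (- rotation \<theta>) = b k - bd k"
proof -
  note [simp] = k
  \<comment> \<open>Commuting with the generator is phrased as a ladder relation with eigenvalue
    0.\<close>
  have "rotation \<theta> * (b k - bd k) = (b k - bd k) * (rotation \<theta> + 0 \<cdot>\<^sub>m 1\<^sub>m N)"
    unfolding rotation_def
  proof (rule finsum_mat_commutator[OF finite_S k])
    fix l assume l: "l \<in> S" "l \<noteq> k"
    show "complex_of_real (\<theta> l) \<cdot>\<^sub>m (b l - bd l) * (b k - bd k) = (b k - bd k) * (complex_of_real (\<theta> l) \<cdot>\<^sub>m (b l - bd l))"
      using l minus_commute_b[OF k l]
      by (simp add: mult_smult_distrib[of _ N N _ N] mult_smult_assoc_mat[of _ N N _ N]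
          mult_minus_distrib_mat[of "b l - bd l" N N _ N] minus_mult_distrib_mat[of _ N N _ "b l - bd l" N])
  next
    show "complex_of_real (\<theta> k) \<cdot>\<^sub>m (b k - bd k) * (b k - bd k)
      = (b k - bd k) * (complex_of_real (\<theta> k) \<cdot>\<^sub>m (b k - bd k)) + 0 \<cdot>\<^sub>m (b k - bd k)"
      by (simp add: mult_smult_distrib[of _ N N _ N] mult_smult_assoc_mat[of _ N N _ N])
        (rule eq_matI; simp add: carrier_matD[OF carriers(5)] carrier_matD[OF b_carrier] del: index_mult_mat(1))
  qed auto
  then have "mat_exp (rotation \<theta>) * (b k - bd k) * mat_exp (- rotation \<theta>) = exp 0 \<cdot>\<^sub>m (b k - bd k)"
    by (intro mat_exp_conjugate_ladder[of _ N]) (use k in auto)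
  also have "exp 0 \<cdot>\<^sub>m (b k - bd k) = b k - bd k" by (rule eq_matI) auto
  finally show ?thesis .
qed

section \<open>Unitarity and expectations in rotated states\<close>

lemma rotation_adjoint: "mat_adjoint (rotation \<theta>) = - rotation \<theta>"
proof (rule eq_matI)
  note [simp] = carrier_matD[OF rotation_carrier] carrier_matD[OF b_carrier]
  have entry: "rotation \<theta> $$ (i, j) = (\<Sum>k\<in>S. of_real (\<theta> k) * (b k $$ (i, j) - cnj (b k $$ (j, i))))"
    if "i < N" "j < N" for i j
    using that unfolding rotation_def by (subst index_finsum_mat) auto
  fix i j assume "i < dim_row (- rotation \<theta>)" "j < dim_col (- rotation \<theta>)"
  then show "mat_adjoint (rotation \<theta>) $$ (i, j) = (- rotation \<theta>) $$ (i, j)"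
    by (simp add: entry algebra_simps flip: sum_negf)
qed (simp_all add: carrier_matD[OF rotation_carrier])

text \<open>The sign is that of the exponent of the Bogoliubov transformation: \<open>gen_B\<close>
  is i times \<open>rotation\<close>, and a further factor i makes it
  \<open>- rotation\<close>.\<close>

abbreviation bogoliubov :: "('k \<Rightarrow> real) \<Rightarrow> complex Matrix.mat" where
  "bogoliubov \<theta> \<equiv> mat_exp (- rotation \<theta>)"

lemma bogoliubov_carrier [simp]: "bogoliubov \<theta> \<in> carrier_mat N N"
  by simp

lemma bogoliubov_adjoint: "mat_adjoint (bogoliubov \<theta>) = mat_exp (rotation \<theta>)"
proof -
  have "mat_adjoint (- rotation \<theta>) = - mat_adjoint (rotation \<theta>)"
    by (rule eq_matI) (auto simp: carrier_matD[OF rotation_carrier])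
  then show ?thesis by (simp add: mat_adjoint_mat_exp[of _ N] rotation_adjoint)
qed

lemma bogoliubov_unitary: "mat_adjoint (bogoliubov \<theta>) * bogoliubov \<theta> = 1\<^sub>m N"
  by (simp add: bogoliubov_adjoint mat_exp_uminus[of _ N])

text \<open>The transformation is moved from the state onto the operator, where the ladder relations
  evaluate it.\<close>

lemma fock_inner_bogoliubov:
  assumes "M \<in> carrier_mat N N" "u \<in> carrier_vec N"
  shows "fock_inner (bogoliubov \<theta> *\<^sub>v u) (M *\<^sub>v (bogoliubov \<theta> *\<^sub>v u))
    = fock_inner u ((mat_exp (rotation \<theta>) * M * bogoliubov \<theta>) *\<^sub>v u)"
proof -
  have c: "bogoliubov \<theta> *\<^sub>v u \<in> carrier_vec N" "mat_exp (rotation \<theta>) * M \<in> carrier_mat N N"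
    using assms by (auto intro!: mult_mat_vec_carrier[of _ N N] mult_carrier_mat[of _ N N])
  have "(mat_exp (rotation \<theta>) * M * bogoliubov \<theta>) *\<^sub>v u = mat_exp (rotation \<theta>) *\<^sub>v (M *\<^sub>v (bogoliubov \<theta> *\<^sub>v u))"
    using assms c by (simp add: assoc_mult_mat_vec[of _ N N _ N])
  moreover have "M *\<^sub>v (bogoliubov \<theta> *\<^sub>v u) \<in> carrier_vec N"
    using assms c by (intro mult_mat_vec_carrier) auto
  moreover have "mat_adjoint (mat_exp (rotation \<theta>)) = bogoliubov \<theta>"
    by (simp flip: bogoliubov_adjoint)
  ultimately show ?thesis
    using assms fock_inner_adjoint[of "mat_exp (rotation \<theta>)" N u "M *\<^sub>v (bogoliubov \<theta> *\<^sub>v u)"] by simp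
qed

lemma fock_inner_ladder:
  assumes "k \<in> S" "u \<in> carrier_vec N"
  shows "fock_inner u (ladder s k *\<^sub>v u) = fock_inner u (b k *\<^sub>v u) + cnj (fock_inner u (b k *\<^sub>v u))
    + s * \<i> * fock_inner u (pair_z k *\<^sub>v u)"
proof -
  have c: "b k *\<^sub>v u \<in> carrier_vec N" "bd k *\<^sub>v u \<in> carrier_vec N" "pair_z k *\<^sub>v u \<in> carrier_vec N"
    using assms by (auto intro!: mult_mat_vec_carrier[of _ N N])
  have "ladder s k *\<^sub>v u = b k *\<^sub>v u + bd k *\<^sub>v u + (s * \<i>) \<cdot>\<^sub>v (pair_z k *\<^sub>v u)"
    using assms unfolding ladder_def
    by (simp add: add_mult_distrib_mat_vec[of _ N N] smult_mat_mult_vec carrier_matD[OF carriers(3)])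
  then show ?thesis
    using assms c fock_inner_adjoint[of "bd k" N u u] fock_inner_cnj[of u N "b k *\<^sub>v u"]
    by (simp add: fock_inner_add_right[of _ N] fock_inner_smult_right[of _ N])
qed

lemma fock_inner_minus_mat:
  assumes "k \<in> S" "u \<in> carrier_vec N"
  shows "fock_inner u ((b k - bd k) *\<^sub>v u) = fock_inner u (b k *\<^sub>v u) - cnj (fock_inner u (b k *\<^sub>v u))"
proof -
  have c: "b k *\<^sub>v u \<in> carrier_vec N" "bd k *\<^sub>v u \<in> carrier_vec N"
    using assms by (auto intro!: mult_mat_vec_carrier[of _ N N])
  have "(b k - bd k) *\<^sub>v u = b k *\<^sub>v u + (-1) \<cdot>\<^sub>v (bd k *\<^sub>v u)"
    using assms c by (simp add: minus_mult_distrib_mat_vec[of _ N N]) (auto intro!: eq_vecI simp: carrier_matD[OF b_carrier])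
  then show ?thesis
    using assms c fock_inner_adjoint[of "bd k" N u u] fock_inner_cnj[of u N "b k *\<^sub>v u"]
    by (simp add: fock_inner_add_right[of _ N] fock_inner_smult_right[of _ N])
qed

text \<open>Conjugating both ladder operators and \<open>b k - bd k\<close> gives three equations
  relating expectations in the rotated state to those in \<open>u\<close>, where only
  \<open>pair_z k\<close> contributes. They determine the expectation of \<open>b k\<close>.\<close>

lemma pair_expectation_rotated:
  assumes k: "k \<in> S" and u: "u \<in> carrier_vec N" and "fock_inner u (b k *\<^sub>v u) = 0"
  shows "fock_inner (bogoliubov \<theta> *\<^sub>v u) (b k *\<^sub>v (bogoliubov \<theta> *\<^sub>v u))
    = complex_of_real (sin (2 * \<theta> k)) / 2 * fock_inner u (pair_z k *\<^sub>v u)"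
proof -
  define x where "x = bogoliubov \<theta> *\<^sub>v u"
  have x: "x \<in> carrier_vec N" unfolding x_def using u by (intro mult_mat_vec_carrier) auto
  define \<beta> where "\<beta> = fock_inner x (b k *\<^sub>v x)"
  define z where "z = fock_inner u (pair_z k *\<^sub>v u)"
  have rot: "fock_inner x (ladder s k *\<^sub>v x) = exp (- 2 * \<i> * s * complex_of_real (\<theta> k)) * (s * \<i> * z)"
    if "s * s = 1" for s
    using that k u assms(3) mult_mat_vec_carrier[OF carriers(4)[OF k] u]
    unfolding x_def z_def by (simp add: fock_inner_bogoliubov rotation_ladder fock_inner_ladder smult_mat_mult_vec
        fock_inner_smult_right[of _ N] carrier_matD[OF carriers(4)] del: mult_minus_left)
  have 1: "\<beta> + cnj \<beta> + \<i> * fock_inner x (pair_z k *\<^sub>v x) = exp (- 2 * \<i> * complex_of_real (\<theta> k)) * (\<i> * z)"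
    using rot[of 1] k x by (simp add: fock_inner_ladder \<beta>_def)
  have 2: "\<beta> + cnj \<beta> - \<i> * fock_inner x (pair_z k *\<^sub>v x) = exp (2 * \<i> * complex_of_real (\<theta> k)) * (- \<i> * z)"
    using rot[of "-1"] k x by (simp add: fock_inner_ladder \<beta>_def)
  \<comment> \<open>\<open>b k - bd k\<close> is invariant under the rotation and has expectation
    zero in \<open>u\<close>, so \<open>\<beta>\<close> is real.\<close>
  have 3: "\<beta> - cnj \<beta> = 0"
    using k u x assms(3) fock_inner_bogoliubov[of "b k - bd k" u \<theta>] fock_inner_minus_mat[OF k u] fock_inner_minus_mat[OF k x]
    by (simp add: \<beta>_def x_def rotation_minus)
  have e1: "exp (2 * \<i> * complex_of_real (\<theta> k)) = cos (2 * \<theta> k) + \<i> * sin (2 * \<theta> k)"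
    and e2: "exp (- 2 * \<i> * complex_of_real (\<theta> k)) = cos (2 * \<theta> k) - \<i> * sin (2 * \<theta> k)"
    using exp_Euler[of "complex_of_real (2 * \<theta> k)"] exp_Euler[of "- complex_of_real (2 * \<theta> k)"]
      cos_of_real[of "2 * \<theta> k", where 'a = complex] sin_of_real[of "2 * \<theta> k", where 'a = complex]
    by (simp_all add: mult_ac)
  \<comment> \<open>Adding the equations for both signs of \<open>s\<close> eliminates the unknown
    expectation of \<open>pair_z k\<close> in the rotated state.\<close>
  have "4 * \<beta> = 2 * (\<beta> + cnj \<beta>)" using 3 by simp
  also have "\<dots> = (\<beta> + cnj \<beta> + \<i> * fock_inner x (pair_z k *\<^sub>v x)) + (\<beta> + cnj \<beta> - \<i> * fock_inner x (pair_z k *\<^sub>v x))"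
    by simp
  also have "\<dots> = exp (- 2 * \<i> * complex_of_real (\<theta> k)) * (\<i> * z) + exp (2 * \<i> * complex_of_real (\<theta> k)) * (- \<i> * z)"
    by (simp only: 1 2)
  also have "\<dots> = 2 * complex_of_real (sin (2 * \<theta> k)) * z"
    unfolding e1 e2 by (simp add: algebra_simps)
  finally show ?thesis by (simp add: \<beta>_def x_def z_def mult.commute)
qed

section \<open>States with one and two pairs\<close>

lemma b_bd_vec:
  assumes "k \<in> S" "l \<in> S" "k \<noteq> l" "x \<in> carrier_vec N"
  shows "b k *\<^sub>v (bd l *\<^sub>v x) = bd l *\<^sub>v (b k *\<^sub>v x)"
  using assms b_adjoint_commute[of l k] by (simp flip: assoc_mult_mat_vec[of _ N N _ N])

lemma bd_bd_vec:
  assumes "k \<in> S" "l \<in> S" "x \<in> carrier_vec N"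
  shows "bd k *\<^sub>v (bd l *\<^sub>v x) = bd l *\<^sub>v (bd k *\<^sub>v x)"
  using assms bd_commute[of l k] by (simp flip: assoc_mult_mat_vec[of _ N N _ N])

lemma bd_square_vec:
  assumes "k \<in> S" "x \<in> carrier_vec N"
  shows "bd k *\<^sub>v (bd k *\<^sub>v x) = 0\<^sub>v N"
  using assms bd_square[of k]
  by (simp flip: assoc_mult_mat_vec[of _ N N _ N]) (auto intro!: eq_vecI)

lemma vec_carriers [simp]:
  assumes "k \<in> S" "x \<in> carrier_vec N"
  shows "b k *\<^sub>v x \<in> carrier_vec N" "bd k *\<^sub>v x \<in> carrier_vec N"
  using assms by (auto intro!: mult_mat_vec_carrier[of _ N N])

lemma mult_zero_vec [simp]:
  assumes "k \<in> S"
  shows "b k *\<^sub>v 0\<^sub>v N = 0\<^sub>v N" "bd k *\<^sub>v 0\<^sub>v N = 0\<^sub>v N"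
  using assms by (auto intro!: eq_vecI simp: carrier_matD[OF b_carrier])

definition single_pair :: "'k \<Rightarrow> complex Matrix.vec" where "single_pair q = bd q *\<^sub>v v0"

definition double_pair :: "'k \<Rightarrow> 'k \<Rightarrow> complex Matrix.vec" where "double_pair p q = bd p *\<^sub>v (bd q *\<^sub>v v0)"

lemma single_pair_carrier [simp]: "q \<in> S \<Longrightarrow> single_pair q \<in> carrier_vec N"
  and double_pair_carrier [simp]: "p \<in> S \<Longrightarrow> q \<in> S \<Longrightarrow> double_pair p q \<in> carrier_vec N"
  by (simp_all add: single_pair_def double_pair_def)

lemma b_single_pair: "k \<in> S \<Longrightarrow> q \<in> S \<Longrightarrow> b k *\<^sub>v single_pair q = (if k = q then v0 else 0\<^sub>v N)"
  by (simp add: single_pair_def b_adjoint_v0 b_bd_vec b_v0)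

lemma b_double_pair:
  assumes "k \<in> S" "p \<in> S" "q \<in> S" "p \<noteq> q"
  shows "b k *\<^sub>v double_pair p q = (if k = p then single_pair q else if k = q then single_pair p else 0\<^sub>v N)"
proof -
  consider "k = p" | "k = q" | "k \<noteq> p" "k \<noteq> q" by blast
  then show ?thesis
  proof cases
    case 1
    \<comment> \<open>The creators are swapped so that \<open>b p\<close>, having passed
      \<open>bd q\<close>, meets \<open>bd p\<close> directly on \<open>v0\<close>.\<close>
    then have "b k *\<^sub>v double_pair p q = b p *\<^sub>v (bd q *\<^sub>v (bd p *\<^sub>v v0))"
      using assms by (simp add: double_pair_def bd_bd_vec[of p q])
    then show ?thesis using 1 assms by (simp add: b_bd_vec b_adjoint_v0 single_pair_def)
  qed (use assms in \<open>simp_all add: double_pair_def single_pair_def b_bd_vec b_v0 b_adjoint_v0\<close>)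
qed

text \<open>The projection onto states whose pair \<open>k\<close> is empty or full. On its range
  \<open>pair_z k\<close> acts as the identity minus twice \<open>bd k * b k\<close>.\<close>

definition unoccupied_or_full :: "'k \<Rightarrow> complex Matrix.mat" where
  "unoccupied_or_full k = b k * bd k + bd k * b k"

lemma unoccupied_or_full_carrier [simp]: "k \<in> S \<Longrightarrow> unoccupied_or_full k \<in> carrier_mat N N"
  by (simp add: unoccupied_or_full_def)

lemma unoccupied_or_full_vec:
  assumes "k \<in> S" "x \<in> carrier_vec N"
  shows "unoccupied_or_full k *\<^sub>v x = b k *\<^sub>v (bd k *\<^sub>v x) + bd k *\<^sub>v (b k *\<^sub>v x)"
  using assms by (simp add: unoccupied_or_full_def add_mult_distrib_mat_vec[of _ N N] assoc_mult_mat_vec[of _ N N _ N])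

lemma unoccupied_or_full_v0: "k \<in> S \<Longrightarrow> unoccupied_or_full k *\<^sub>v v0 = v0"
  by (simp add: unoccupied_or_full_vec b_adjoint_v0 b_v0)

text \<open>Creating a different pair commutes with the projection; creating the same pair lands in
  its range by the partial isometry relation. Thus the range contains all states built from
  \<open>v0\<close>.\<close>

lemma unoccupied_or_full_bd:
  assumes "k \<in> S" "q \<in> S" "x \<in> carrier_vec N" "unoccupied_or_full k *\<^sub>v x = x"
  shows "unoccupied_or_full k *\<^sub>v (bd q *\<^sub>v x) = bd q *\<^sub>v x"
proof (cases "k = q")
  case True
  have "bd q *\<^sub>v (b q *\<^sub>v (bd q *\<^sub>v x)) = bd q *\<^sub>v x"
    using assms bd_partial_isometry[of q] assoc_mult_mat_vec[of "bd q" N N "b q" N "bd q *\<^sub>v x"]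
      assoc_mult_mat_vec[of "bd q * b q" N N "bd q" N x] by simp
  then show ?thesis using assms True by (simp add: unoccupied_or_full_vec bd_square_vec)
next
  case False
  then have "unoccupied_or_full k *\<^sub>v (bd q *\<^sub>v x) = bd q *\<^sub>v (unoccupied_or_full k *\<^sub>v x)"
    using assms(1-3) by (simp add: unoccupied_or_full_vec b_bd_vec bd_bd_vec[of k q] mult_add_distrib_mat_vec[of _ N N])
  then show ?thesis using assms by simp
qed

text \<open>On \<open>u\<close> the products \<open>b k * bd k\<close> and \<open>bd k * b k\<close>
  add up to the identity, while \<open>pair_z k\<close> is their difference. The expectation of the
  second is a squared norm.\<close>

lemma fock_inner_pair_z:
  assumes "k \<in> S" "u \<in> carrier_vec N" "unoccupied_or_full k *\<^sub>v u = u"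
  shows "fock_inner u (pair_z k *\<^sub>v u) = fock_inner u u - 2 * fock_inner (b k *\<^sub>v u) (b k *\<^sub>v u)"
proof -
  have "pair_z k *\<^sub>v u = b k *\<^sub>v (bd k *\<^sub>v u) + (-1) \<cdot>\<^sub>v (bd k *\<^sub>v (b k *\<^sub>v u))"
    using assms(1,2) unfolding pair_z_def
    by (simp add: minus_mult_distrib_mat_vec[of _ N N] assoc_mult_mat_vec[of _ N N _ N])
      (auto intro!: eq_vecI simp: carrier_matD[OF b_carrier])
  then have "fock_inner u (pair_z k *\<^sub>v u) = fock_inner u (b k *\<^sub>v (bd k *\<^sub>v u)) - fock_inner u (bd k *\<^sub>v (b k *\<^sub>v u))"
    using assms(1,2) by (simp add: fock_inner_add_right[of _ N] fock_inner_smult_right[of _ N])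
  moreover have "fock_inner u u = fock_inner u (b k *\<^sub>v (bd k *\<^sub>v u)) + fock_inner u (bd k *\<^sub>v (b k *\<^sub>v u))"
    using assms unoccupied_or_full_vec[of k u] by (simp flip: fock_inner_add_right[of _ N])
  moreover have "fock_inner u (bd k *\<^sub>v (b k *\<^sub>v u)) = fock_inner (b k *\<^sub>v u) (b k *\<^sub>v u)"
    using assms fock_inner_adjoint[of "bd k" N u "b k *\<^sub>v u"] by simp
  ultimately show ?thesis by simp
qed

text \<open>The sum runs over ordered pairs; for symmetric \<open>w\<close> the factor 1/2
  compensates that each unordered pair occurs twice.\<close>

definition two_pairs :: "('k \<Rightarrow> 'k \<Rightarrow> real) \<Rightarrow> complex Matrix.vec" where
  "two_pairs w = (1 / 2) \<cdot>\<^sub>v finsum_vec TYPE(complex) N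
     (\<lambda>(p, q). complex_of_real (w p q) \<cdot>\<^sub>v double_pair p q) (S \<times> S)"

lemma two_pairs_carrier [simp]: "two_pairs w \<in> carrier_vec N"
  by (auto simp: two_pairs_def intro!: finsum_vec_closed)

text \<open>The pair \<open>k\<close> can be removed from either position. The two contributions
  agree by symmetry, which cancels the factor 1/2. The zero diagonal settles \<open>p = q\<close>, a
  case outside \<open>b_double_pair\<close>.\<close>

lemma b_two_pairs:
  assumes k: "k \<in> S" and sym: "\<And>p q. p \<in> S \<Longrightarrow> q \<in> S \<Longrightarrow> w q p = w p q"
    and diag: "\<And>p. p \<in> S \<Longrightarrow> w p p = 0"
  shows "b k *\<^sub>v two_pairs w = finsum_vec TYPE(complex) N (\<lambda>q. complex_of_real (w k q) \<cdot>\<^sub>v single_pair q) S"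
    (is "_ = finsum_vec _ _ ?g S")
proof (rule eq_vecI)
  have g: "?g \<in> S \<rightarrow> carrier_vec N" by auto
  then have dim: "dim_vec (finsum_vec TYPE(complex) N ?g S) = N"
    using finsum_vec_closed[OF g] by auto
  then show "dim_vec (b k *\<^sub>v two_pairs w) = dim_vec (finsum_vec TYPE(complex) N ?g S)"
    using k by (simp add: carrier_matD[OF b_carrier])
  fix i assume "i < dim_vec (finsum_vec TYPE(complex) N ?g S)"
  with dim have i: "i < N" by simp
  let ?f = "\<lambda>(p, q). complex_of_real (w p q) \<cdot>\<^sub>v double_pair p q"
  have f: "?f \<in> S \<times> S \<rightarrow> carrier_vec N" by auto
  have bf: "(\<lambda>x. b k *\<^sub>v ?f x) \<in> S \<times> S \<rightarrow> carrier_vec N"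
    using k by (auto simp del: index_mult_mat_vec)
  have "b k *\<^sub>v finsum_vec TYPE(complex) N ?f (S \<times> S) = finsum_vec TYPE(complex) N (\<lambda>x. b k *\<^sub>v ?f x) (S \<times> S)"
    using k by (intro mult_mat_vec_finsum) auto
  then have "b k *\<^sub>v two_pairs w = (1 / 2) \<cdot>\<^sub>v finsum_vec TYPE(complex) N (\<lambda>x. b k *\<^sub>v ?f x) (S \<times> S)"
    using k finsum_vec_closed[OF f] by (simp add: two_pairs_def mult_mat_vec[of _ N N])
  then have "(b k *\<^sub>v two_pairs w) $ i = 1 / 2 * (\<Sum>x\<in>S \<times> S. (b k *\<^sub>v ?f x) $ i)"
    using i bf finsum_vec_closed[OF bf] by (simp add: index_finsum_vec del: index_mult_mat_vec)
  also have "(\<Sum>x\<in>S \<times> S. (b k *\<^sub>v ?f x) $ i) = (\<Sum>p\<in>S. \<Sum>q\<in>S. (b k *\<^sub>v ?f (p, q)) $ i)"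
    by (simp add: sum.cartesian_product case_prod_unfold)
  also have "\<dots> = (\<Sum>p\<in>S. \<Sum>q\<in>S. (if p = k then w p q * single_pair q $ i else 0) + (if q = k then w p q * single_pair p $ i else 0))"
  proof (intro sum.cong refl)
    fix p q assume pq: "p \<in> S" "q \<in> S"
    have "b k *\<^sub>v ?f (p, q) = complex_of_real (w p q) \<cdot>\<^sub>v (b k *\<^sub>v double_pair p q)"
      using k pq by (simp add: mult_mat_vec[of _ N N])
    then have "(b k *\<^sub>v ?f (p, q)) $ i = w p q * (b k *\<^sub>v double_pair p q) $ i"
      using i k pq by (simp add: carrier_matD[OF b_carrier] del: index_mult_mat_vec)
    also have "\<dots> = (if p = k then w p q * single_pair q $ i else 0) + (if q = k then w p q * single_pair p $ i else 0)"
      using k pq i diag[of p] by (cases "p = q") (auto simp: b_double_pair simp del: index_mult_mat_vec)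
    finally show "(b k *\<^sub>v ?f (p, q)) $ i
      = (if p = k then w p q * single_pair q $ i else 0) + (if q = k then w p q * single_pair p $ i else 0)" .
  qed
  also have "\<dots> = (\<Sum>p\<in>S. \<Sum>q\<in>S. if p = k then w p q * single_pair q $ i else 0) + (\<Sum>p\<in>S. w p k * single_pair p $ i)"
    using k by (simp add: sum.distrib sum.delta)
  also have "(\<Sum>p\<in>S. \<Sum>q\<in>S. if p = k then w p q * single_pair q $ i else 0)
      = (\<Sum>q\<in>S. \<Sum>p\<in>S. if p = k then w p q * single_pair q $ i else 0)"
    by (rule sum.swap)
  also have "\<dots> + (\<Sum>p\<in>S. w p k * single_pair p $ i) = 2 * (\<Sum>q\<in>S. w k q * single_pair q $ i)"
    using k by (simp add: sum.delta sym[of k])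
  finally show "(b k *\<^sub>v two_pairs w) $ i = finsum_vec TYPE(complex) N ?g S $ i"
    using i g by (simp add: index_finsum_vec carrier_vecD[OF single_pair_carrier] del: index_mult_mat_vec)
qed

lemma b_b_two_pairs:
  assumes "k \<in> S" "l \<in> S" "\<And>p q. p \<in> S \<Longrightarrow> q \<in> S \<Longrightarrow> w q p = w p q" "\<And>p. p \<in> S \<Longrightarrow> w p p = 0"
  shows "b l *\<^sub>v (b k *\<^sub>v two_pairs w) = complex_of_real (w k l) \<cdot>\<^sub>v v0"
proof (rule eq_vecI)
  let ?g = "\<lambda>q. b l *\<^sub>v (complex_of_real (w k q) \<cdot>\<^sub>v single_pair q)"
  have g: "?g \<in> S \<rightarrow> carrier_vec N" using assms by auto
  show "dim_vec (b l *\<^sub>v (b k *\<^sub>v two_pairs w)) = dim_vec (complex_of_real (w k l) \<cdot>\<^sub>v v0)"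
    using assms by (simp add: carrier_matD[OF b_carrier] carrier_vecD[OF v0_carrier])
  fix i assume "i < dim_vec (complex_of_real (w k l) \<cdot>\<^sub>v v0)"
  then have i: "i < N" by (simp add: carrier_vecD[OF v0_carrier])
  have "b l *\<^sub>v (b k *\<^sub>v two_pairs w) = finsum_vec TYPE(complex) N ?g S"
    using assms by (simp add: b_two_pairs mult_mat_vec_finsum)
  then have "(b l *\<^sub>v (b k *\<^sub>v two_pairs w)) $ i = (\<Sum>q\<in>S. ?g q $ i)"
    using i g by (simp add: index_finsum_vec del: index_mult_mat_vec)
  also have "\<dots> = (\<Sum>q\<in>S. if l = q then w k q * v0 $ i else 0)"
    using assms(1,2) i by (intro sum.cong refl)
      (auto simp: mult_mat_vec[of _ N N] b_single_pair carrier_vecD[OF v0_carrier] simp del: index_mult_mat_vec)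
  finally show "(b l *\<^sub>v (b k *\<^sub>v two_pairs w)) $ i = (complex_of_real (w k l) \<cdot>\<^sub>v v0) $ i"
    using assms(2) i by (simp add: sum.delta' carrier_vecD[OF v0_carrier])
qed

text \<open>The creators on the left become annihilators on the right, where
  \<open>b_b_two_pairs\<close> reads off coefficients; no inner products between two-pair states
  have to be tabulated.\<close>

lemma fock_inner_two_pairs:
  assumes x: "x \<in> carrier_vec N"
  shows "fock_inner (two_pairs w) x = 1 / 2 * (\<Sum>p\<in>S. \<Sum>q\<in>S. w p q * fock_inner v0 (b q *\<^sub>v (b p *\<^sub>v x)))"
proof -
  let ?f = "\<lambda>(p, q). complex_of_real (w p q) \<cdot>\<^sub>v double_pair p q"
  have f: "?f \<in> S \<times> S \<rightarrow> carrier_vec N" by auto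
  have "fock_inner (two_pairs w) x = 1 / 2 * (\<Sum>y\<in>S \<times> S. fock_inner (?f y) x)"
    unfolding two_pairs_def using x finsum_vec_closed[OF f]
    by (subst fock_inner_smult_left[of _ N], simp, simp, subst fock_inner_finsum_left) auto
  also have "(\<Sum>y\<in>S \<times> S. fock_inner (?f y) x) = (\<Sum>p\<in>S. \<Sum>q\<in>S. fock_inner (?f (p, q)) x)"
    by (simp add: sum.cartesian_product case_prod_unfold)
  also have "\<dots> = (\<Sum>p\<in>S. \<Sum>q\<in>S. w p q * fock_inner v0 (b q *\<^sub>v (b p *\<^sub>v x)))"
    using x by (intro sum.cong refl) (simp add: fock_inner_smult_left[of _ N] double_pair_def fock_inner_adjoint[of _ N])
  finally show ?thesis .
qed

lemma unoccupied_or_full_two_pairs: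
  assumes k: "k \<in> S"
  shows "unoccupied_or_full k *\<^sub>v two_pairs w = two_pairs w"
proof -
  let ?f = "\<lambda>(p, q). complex_of_real (w p q) \<cdot>\<^sub>v double_pair p q"
  have f: "?f \<in> S \<times> S \<rightarrow> carrier_vec N" by auto
  have "unoccupied_or_full k *\<^sub>v finsum_vec TYPE(complex) N ?f (S \<times> S)
      = finsum_vec TYPE(complex) N (\<lambda>x. unoccupied_or_full k *\<^sub>v ?f x) (S \<times> S)"
    using k f by (intro mult_mat_vec_finsum) auto
  also have "\<dots> = finsum_vec TYPE(complex) N ?f (S \<times> S)"
    using k by (intro finsum_vec_cong)
      (auto simp: mult_mat_vec[of _ N N] double_pair_def unoccupied_or_full_bd unoccupied_or_full_v0)
  finally show ?thesis
    using k finsum_vec_closed[OF f] by (simp add: two_pairs_def mult_mat_vec[of _ N N])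
qed

text \<open>By \<open>pair_expectation_rotated\<close> only expectations in the unrotated state
  \<open>u\<close> are to be computed. \<open>D\<close> counts ordered pairs, so the two-pair part
  has squared norm \<open>D / 2\<close>.\<close>

lemma rotated_two_pair_expectation:
  assumes k: "k \<in> S" and sym: "\<And>p q. p \<in> S \<Longrightarrow> q \<in> S \<Longrightarrow> w q p = w p q"
    and diag: "\<And>p. p \<in> S \<Longrightarrow> w p p = 0"
  defines "u \<equiv> v0 + two_pairs w"
  defines "D \<equiv> (\<Sum>p\<in>S. \<Sum>q\<in>S. (w p q)\<^sup>2)"
  shows "fock_inner (bogoliubov \<theta> *\<^sub>v two_pairs w) (bogoliubov \<theta> *\<^sub>v two_pairs w) = of_real (D / 2)"
    and "fock_inner (bogoliubov \<theta> *\<^sub>v u) (b k *\<^sub>v (bogoliubov \<theta> *\<^sub>v u))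
      = of_real (sin (2 * \<theta> k) / 2 * (1 + D / 2 - 2 * (\<Sum>q\<in>S. (w k q)\<^sup>2)))"
proof -
  note bb = b_b_two_pairs[of _ _ w, OF _ _ sym diag]
  have u: "u \<in> carrier_vec N" by (simp add: u_def)
  have norm: "fock_inner (two_pairs w) (two_pairs w) = of_real (D / 2)"
    by (simp add: fock_inner_two_pairs bb fock_inner_smult_right[of _ N] v0_norm D_def power2_eq_square)
  \<comment> \<open>The identity is inserted as the operator, so that
    \<open>fock_inner_bogoliubov\<close> gives preservation of the norm.\<close>
  have "fock_inner (bogoliubov \<theta> *\<^sub>v two_pairs w) (1\<^sub>m N *\<^sub>v (bogoliubov \<theta> *\<^sub>v two_pairs w))
      = fock_inner (two_pairs w) (two_pairs w)"
    using bogoliubov_unitary[of \<theta>] by (simp add: fock_inner_bogoliubov bogoliubov_adjoint right_mult_one_mat[of _ N N])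
  then show "fock_inner (bogoliubov \<theta> *\<^sub>v two_pairs w) (bogoliubov \<theta> *\<^sub>v two_pairs w) = of_real (D / 2)"
    using mult_mat_vec_carrier[OF bogoliubov_carrier two_pairs_carrier, of \<theta> w] by (simp add: norm)
  have bu: "b k *\<^sub>v u = b k *\<^sub>v two_pairs w"
    using k by (simp add: u_def mult_add_distrib_mat_vec[of _ N N] b_v0)
  have v0_bd: "fock_inner v0 (bd q *\<^sub>v x) = 0" if "q \<in> S" "x \<in> carrier_vec N" for q x
    using that by (simp add: fock_inner_adjoint[of _ N] b_v0)
  \<comment> \<open>\<open>b k\<close> removes one pair, whereas \<open>u\<close> has components
    with no pair and with two pairs only; hence its expectation in \<open>u\<close>
    vanishes.\<close>
  have "fock_inner v0 (b k *\<^sub>v two_pairs w) = 0"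
    using k sym diag v0_bd[of _ v0]
    by (simp add: b_two_pairs fock_inner_finsum_right[of _ _ N] fock_inner_smult_right[of _ N] single_pair_def)
  moreover have "fock_inner (two_pairs w) (b k *\<^sub>v two_pairs w) = 0"
    using k by (simp add: fock_inner_two_pairs bb mult_mat_vec[of _ N N] b_v0 fock_inner_smult_right[of _ N])
  ultimately have ub: "fock_inner u (b k *\<^sub>v u) = 0"
    using k unfolding bu by (simp add: u_def fock_inner_add_left[of _ N])
  have ortho: "fock_inner (two_pairs w) v0 = 0"
    by (simp add: fock_inner_two_pairs b_v0)
  then have "fock_inner v0 (two_pairs w) = 0"
    using fock_inner_cnj[of "two_pairs w" N v0] by simp
  then have uu: "fock_inner u u = of_real (1 + D / 2)"
    using ortho norm by (simp add: u_def fock_inner_add_left[of _ N] fock_inner_add_right[of _ N] v0_norm)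
  \<comment> \<open>Only the second factor is expanded into single pairs. Each of them then acts as
    an annihilator on the first factor and extracts \<open>w k q\<close>.\<close>
  have "fock_inner (b k *\<^sub>v u) (b k *\<^sub>v u) = (\<Sum>q\<in>S. w k q * fock_inner (b k *\<^sub>v two_pairs w) (single_pair q))"
    using k sym diag unfolding bu
    by (subst (2) b_two_pairs) (simp_all add: fock_inner_finsum_right[of _ _ N] fock_inner_smult_right[of _ N])
  also have "\<dots> = (\<Sum>q\<in>S. (w k q)\<^sup>2)"
  proof -
    have "fock_inner (b k *\<^sub>v two_pairs w) (single_pair q) = w k q" if "q \<in> S" for q
      using k that by (simp add: single_pair_def fock_inner_adjoint[of _ N] bb fock_inner_smult_left[of _ N] v0_norm)
    then show ?thesis by (simp add: power2_eq_square)
  qed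
  finally have "fock_inner u (pair_z k *\<^sub>v u) = of_real (1 + D / 2 - 2 * (\<Sum>q\<in>S. (w k q)\<^sup>2))"
    using k u uu
    by (simp add: fock_inner_pair_z u_def mult_add_distrib_mat_vec[of "unoccupied_or_full k" N N]
        unoccupied_or_full_v0 unoccupied_or_full_two_pairs)
  then show "fock_inner (bogoliubov \<theta> *\<^sub>v u) (b k *\<^sub>v (bogoliubov \<theta> *\<^sub>v u))
      = of_real (sin (2 * \<theta> k) / 2 * (1 + D / 2 - 2 * (\<Sum>q\<in>S. (w k q)\<^sup>2)))"
    using pair_expectation_rotated[OF k u ub, of \<theta>] by simp
qed

end

section \<open>The Bogoliubov transformation on Fock space\<close>

lemma mode_nth:
  "distinct ks \<Longrightarrow> j < length ks \<Longrightarrow> mode ks (ks ! j) \<sigma> = 2 * j + (case \<sigma> of Up \<Rightarrow> 0 | Down \<Rightarrow> 1)"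
  unfolding mode_def by (subst the_equality[of _ j]) (auto simp: nth_eq_iff_index_eq)

lemma mode_less:
  assumes "distinct ks" "k \<in> set ks"
  shows "mode ks k \<sigma> < 2 * length ks"
proof -
  obtain j where "j < length ks" "k = ks ! j" using assms by (metis in_set_conv_nth)
  then show ?thesis using assms by (simp add: mode_nth split: spin.split)
qed

lemma mode_eq_iff:
  assumes "distinct ks" "k \<in> set ks" "l \<in> set ks"
  shows "mode ks k \<sigma> = mode ks l \<tau> \<longleftrightarrow> k = l \<and> \<sigma> = \<tau>"
proof -
  obtain i j where ij: "i < length ks" "k = ks ! i" "j < length ks" "l = ks ! j"
    using assms by (metis in_set_conv_nth)
  then have "mode ks k \<sigma> = mode ks l \<tau> \<longleftrightarrow> i = j \<and> \<sigma> = \<tau>"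
    using assms(1) by (auto simp: mode_nth split: spin.split) presburger+
  then show ?thesis using ij assms(1) by (simp add: nth_eq_iff_index_eq)
qed

section \<open>Momentum pairs as an instance of the pair algebra\<close>

definition pair_op :: "(real ^ 3) list \<Rightarrow> real ^ 3 \<Rightarrow> complex Matrix.mat" where
  "pair_op ks k = annih ks (-k) Down * annih ks k Up"

lemma pair_op_carrier [simp]: "pair_op ks k \<in> carrier_mat (fock_dim ks) (fock_dim ks)"
  unfolding pair_op_def by (rule mult_carrier_mat[of _ _ "fock_dim ks"]) auto

lemma vacuum_eq: "vacuum ks = Matrix.vec (fock_dim ks) (\<lambda>n. if n = 0 then 1 else 0)"
  by (simp add: vacuum_def unit_vec_def)

locale symmetric_momenta =
  fixes ks :: "(real ^ 3) list"
  assumes distinct_ks: "distinct ks" and uminus_mem: "k \<in> set ks \<Longrightarrow> -k \<in> set ks"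
begin

abbreviation Nk :: nat where "Nk \<equiv> fock_dim ks"

lemma pair_op_vec:
  "k \<in> set ks \<Longrightarrow> pair_op ks k *\<^sub>v Matrix.vec Nk f
    = Matrix.vec Nk (pair_lower (mode ks k Up) (mode ks (-k) Down) f)"
  by (simp add: pair_op_def assoc_mult_mat_vec[of _ Nk Nk _ Nk] annih_mult_vec mode_less distinct_ks
      uminus_mem pair_lower_def)

lemma pair_op_adjoint:
  "k \<in> set ks \<Longrightarrow> mat_adjoint (pair_op ks k) = creat ks k Up * creat ks (-k) Down"
  by (simp add: pair_op_def mat_adjoint_mult[of _ Nk Nk _ Nk] creat_eq_adjoint_annih mode_less distinct_ks uminus_mem)

lemma pair_op_adjoint_vec:
  "k \<in> set ks \<Longrightarrow> mat_adjoint (pair_op ks k) *\<^sub>v Matrix.vec Nk f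
    = Matrix.vec Nk (pair_raise (mode ks k Up) (mode ks (-k) Down) f)"
  by (simp add: pair_op_adjoint assoc_mult_mat_vec[of _ Nk Nk _ Nk] creat_mult_vec mode_less distinct_ks
      uminus_mem pair_raise_def)

text \<open>Either mode of a pair determines \<open>k\<close>, and modes of opposite spin never
  coincide, not even when \<open>k = 0\<close>.\<close>

lemma modes_disjoint:
  assumes "k \<in> set ks" "l \<in> set ks" "k \<noteq> l"
  shows "{mode ks k Up, mode ks (-k) Down} \<inter> {mode ks l Up, mode ks (-l) Down} = {}"
  using assms by (auto simp: mode_eq_iff distinct_ks uminus_mem)

lemma modes_distinct: "k \<in> set ks \<Longrightarrow> mode ks k Up \<noteq> mode ks (-k) Down"
  by (simp add: mode_eq_iff distinct_ks uminus_mem)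

text \<open>The operator relations are tested on coefficient functions, on which
  \<open>pair_op\<close> acts as \<open>pair_lower\<close> and its adjoint as
  \<open>pair_raise\<close>.\<close>

sublocale commuting_pairs "fock_dim ks" "set ks" "pair_op ks" "vacuum ks"
proof
  note [simp] = pair_op_vec pair_op_adjoint_vec assoc_mult_mat_vec[of _ Nk Nk _ Nk]
  show "vacuum ks \<in> carrier_vec Nk" by (simp add: vacuum_eq)
  fix k assume k: "k \<in> set ks"
  show "pair_op ks k * pair_op ks k = 0\<^sub>m Nk Nk"
    by (rule mat_eqI_vec[of _ Nk Nk])
      (use k in \<open>auto simp: pair_lower_pair_lower intro!: mult_carrier_mat[of _ _ Nk] eq_vecI\<close>)
  have PP: "pair_op ks k * mat_adjoint (pair_op ks k) \<in> carrier_mat Nk Nk"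
    by (rule mult_carrier_mat[of _ _ Nk]) auto
  show "pair_op ks k * mat_adjoint (pair_op ks k) * pair_op ks k = pair_op ks k"
    by (rule mat_eqI_vec[of _ Nk Nk])
      (use k PP in \<open>auto simp: pair_lower_raise_lower modes_distinct intro!: mult_carrier_mat[of _ _ Nk]\<close>)
  show "pair_op ks k *\<^sub>v vacuum ks = 0\<^sub>v Nk"
    using k by (auto simp: vacuum_eq pair_lower_vacuum intro!: eq_vecI)
  show "pair_op ks k *\<^sub>v (mat_adjoint (pair_op ks k) *\<^sub>v vacuum ks) = vacuum ks"
    using k by (simp add: vacuum_eq pair_lower_raise_vacuum modes_distinct)
  fix l assume l: "l \<in> set ks"
  show "pair_op ks k * pair_op ks l = pair_op ks l * pair_op ks k"
  proof (cases "k = l")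
    case False
    show ?thesis
      by (rule mat_eqI_vec[of _ Nk Nk])
        (use k l in \<open>auto simp: pair_lower_commute[OF modes_disjoint[OF k l False]] intro!: mult_carrier_mat[of _ _ Nk]\<close>)
  qed simp
  assume kl: "k \<noteq> l"
  show "mat_adjoint (pair_op ks k) * pair_op ks l = pair_op ks l * mat_adjoint (pair_op ks k)"
    by (rule mat_eqI_vec[of _ Nk Nk])
      (use k l in \<open>auto simp: pair_raise_lower_commute[OF modes_disjoint[OF k l kl]] intro!: mult_carrier_mat[of _ _ Nk]\<close>)
next
  have "0 < Nk" by (simp add: fock_dim_def)
  then show "fock_inner (vacuum ks) (vacuum ks) = 1"
    by (simp add: fock_inner_sum[of _ Nk] vacuum_eq if_distrib[of cnj] if_distrib[of "\<lambda>x. x * _"] sum.delta cong: if_cong)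
qed auto

lemma gen_B_eq: "gen_B ks \<theta> = \<i> \<cdot>\<^sub>m rotation \<theta>"
proof -
  interpret M: abelian_group "module_mat TYPE(complex) Nk Nk" by (rule abelian_group_mat)
  have "finsum_mat Nk (\<lambda>k. complex_of_real (\<theta> k) \<cdot>\<^sub>m
          (annih ks (-k) Down * annih ks k Up - creat ks k Up * creat ks (-k) Down)) (set ks) = rotation \<theta>"
    unfolding rotation_def
    by (intro M.finsum_cong') (auto simp: module_mat_simps pair_op_adjoint[symmetric] pair_op_def[symmetric])
  then show ?thesis by (simp add: gen_B_def)
qed

lemma gen_B_smult: "\<i> \<cdot>\<^sub>m gen_B ks \<theta> = - rotation \<theta>" "(-\<i>) \<cdot>\<^sub>m gen_B ks \<theta> = rotation \<theta>"
  by (auto simp: gen_B_eq intro!: eq_matI)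

lemma psi_BCS_eq: "psi_BCS ks \<theta> = bogoliubov \<theta> *\<^sub>v vacuum ks"
  by (simp add: psi_BCS_def gen_B_smult)

lemma gam_adj_eq:
  assumes "k \<in> set ks"
  shows "gam_adj ks \<theta> k \<sigma> = bogoliubov \<theta> * creat ks k \<sigma> * mat_exp (rotation \<theta>)"
proof -
  have "bogoliubov \<theta> * annih ks k \<sigma> \<in> carrier_mat Nk Nk"
    by (rule mult_carrier_mat[of _ _ Nk]) auto
  moreover have "mat_adjoint (mat_exp (rotation \<theta>)) = bogoliubov \<theta>"
    by (simp flip: bogoliubov_adjoint)
  ultimately have "gam_adj ks \<theta> k \<sigma> = bogoliubov \<theta> * (creat ks k \<sigma> * mat_exp (rotation \<theta>))"
    using assms by (simp add: gam_def gen_B_smult mat_adjoint_mult[of _ Nk Nk _ Nk] bogoliubov_adjoint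
        creat_eq_adjoint_annih mode_less distinct_ks)
  then show ?thesis by (simp add: assoc_mult_mat[of _ Nk Nk _ Nk _ Nk])
qed

lemma gam_adj_carrier [simp]: "gam_adj ks \<theta> k \<sigma> \<in> carrier_mat Nk Nk"
  unfolding gam_def gen_B_smult
  by (intro mat_adjoint_carrier mult_carrier_mat[of _ Nk Nk]) auto

text \<open>The adjacent unitary factors cancel, so a transformed creator acts on a transformed
  vector as the plain creator does before the transformation.\<close>

lemma gam_adj_vec:
  assumes "k \<in> set ks" "x \<in> carrier_vec Nk"
  shows "gam_adj ks \<theta> k \<sigma> *\<^sub>v (bogoliubov \<theta> *\<^sub>v x) = bogoliubov \<theta> *\<^sub>v (creat ks k \<sigma> *\<^sub>v x)"
proof -
  have c: "bogoliubov \<theta> * creat ks k \<sigma> \<in> carrier_mat Nk Nk" "bogoliubov \<theta> *\<^sub>v x \<in> carrier_vec Nk"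
    using assms by (auto intro!: mult_carrier_mat[of _ _ Nk] mult_mat_vec_carrier[of _ Nk Nk])
  have "gam_adj ks \<theta> k \<sigma> *\<^sub>v (bogoliubov \<theta> *\<^sub>v x)
      = (bogoliubov \<theta> * creat ks k \<sigma>) *\<^sub>v ((mat_exp (rotation \<theta>) * bogoliubov \<theta>) *\<^sub>v x)"
    using assms c unfolding gam_adj_eq[OF assms(1)] by (simp add: assoc_mult_mat_vec[of _ Nk Nk _ Nk])
  also have "mat_exp (rotation \<theta>) * bogoliubov \<theta> = 1\<^sub>m Nk"
    using bogoliubov_unitary[of \<theta>] by (simp add: bogoliubov_adjoint)
  finally show ?thesis using assms by (simp add: assoc_mult_mat_vec[of _ Nk Nk _ Nk])
qed

text \<open>The BCS state is the transformed vacuum, so \<open>gam_adj_vec\<close> applies four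
  times; consecutive creators then regroup into adjoint pair operators.\<close>

lemma gam_adj_pairs:
  assumes "p \<in> set ks" "q \<in> set ks"
  shows "gam_adj ks \<theta> p Up * gam_adj ks \<theta> (-p) Down * gam_adj ks \<theta> q Up * gam_adj ks \<theta> (-q) Down
      *\<^sub>v psi_BCS ks \<theta> = bogoliubov \<theta> *\<^sub>v double_pair p q"
proof -
  have v: "creat ks k \<sigma> *\<^sub>v x \<in> carrier_vec Nk" "bogoliubov \<theta> *\<^sub>v x \<in> carrier_vec Nk"
    "gam_adj ks \<theta> k \<sigma> *\<^sub>v x \<in> carrier_vec Nk" if "x \<in> carrier_vec Nk" for k \<sigma> x
    using that by (auto intro!: mult_mat_vec_carrier[of _ Nk Nk])
  have m: "A * gam_adj ks \<theta> k \<sigma> \<in> carrier_mat Nk Nk" if "A \<in> carrier_mat Nk Nk" for A k \<sigma>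
    using that by (auto intro!: mult_carrier_mat[of _ _ Nk])
  have "gam_adj ks \<theta> p Up * gam_adj ks \<theta> (-p) Down * gam_adj ks \<theta> q Up * gam_adj ks \<theta> (-q) Down *\<^sub>v psi_BCS ks \<theta>
    = gam_adj ks \<theta> p Up *\<^sub>v (gam_adj ks \<theta> (-p) Down *\<^sub>v (gam_adj ks \<theta> q Up *\<^sub>v (gam_adj ks \<theta> (-q) Down *\<^sub>v psi_BCS ks \<theta>)))"
    by (simp add: psi_BCS_eq assoc_mult_mat_vec[of _ Nk Nk "gam_adj _ _ _ _" Nk] v m)
  then show ?thesis
    using assms by (simp add: psi_BCS_eq gam_adj_vec v uminus_mem double_pair_def pair_op_adjoint
        assoc_mult_mat_vec[of _ Nk Nk "creat _ _ _" Nk])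
qed

lemma phi_eq:
  "phi ks U E \<theta> = bogoliubov \<theta> *\<^sub>v two_pairs (\<lambda>p q. U p q * ((cos (\<theta> p))\<^sup>2 * (sin (\<theta> q))\<^sup>2
      + (cos (\<theta> q))\<^sup>2 * (sin (\<theta> p))\<^sup>2) / (E p + E q))"
  (is "_ = _ *\<^sub>v two_pairs ?w")
proof -
  let ?f = "\<lambda>(p, q). complex_of_real (?w p q) \<cdot>\<^sub>v double_pair p q"
  have f: "?f \<in> set ks \<times> set ks \<rightarrow> carrier_vec Nk" by auto
  have "phi ks U E \<theta> = (1 / 2) \<cdot>\<^sub>v finsum_vec TYPE(complex) Nk (\<lambda>x. bogoliubov \<theta> *\<^sub>v ?f x) (set ks \<times> set ks)"
    unfolding phi_def
    by (intro arg_cong[where f = "\<lambda>v. (1 / 2) \<cdot>\<^sub>v v"] finsum_vec_cong)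
      (auto simp: gam_adj_pairs mult_mat_vec[OF bogoliubov_carrier] intro!: mult_mat_vec_carrier[of _ Nk Nk])
  also have "finsum_vec TYPE(complex) Nk (\<lambda>x. bogoliubov \<theta> *\<^sub>v ?f x) (set ks \<times> set ks)
      = bogoliubov \<theta> *\<^sub>v finsum_vec TYPE(complex) Nk ?f (set ks \<times> set ks)"
    by (intro mult_mat_vec_finsum[symmetric]) auto
  finally show ?thesis
    unfolding two_pairs_def using finsum_vec_closed[OF f] by (simp add: mult_mat_vec[OF bogoliubov_carrier])
qed

end

section \<open>From the two-pair expectation to the gap equation\<close>

text \<open>With the cosine of the doubled angle equal to \<open>\<xi> k / E k\<close>, this turns
  the trigonometric weight in \<open>phi\<close> into the factor occurring in
  \<open>D_mom\<close>.\<close>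

lemma cos_sin_mix:
  fixes x y :: real
  shows "(cos x)\<^sup>2 * (sin y)\<^sup>2 + (cos y)\<^sup>2 * (sin x)\<^sup>2 = (1 - cos (2 * x) * cos (2 * y)) / 2"
  unfolding sin_squared_eq cos_double_cos by (simp add: algebra_simps)

lemma uminus_mem_momenta:
  assumes "k \<in> momenta L Kmax"
  shows "-k \<in> momenta L Kmax"
proof -
  obtain n1 n2 n3 where k: "k = (2 * pi / L) *\<^sub>R vector [real_of_int n1, real_of_int n2, real_of_int n3]"
    and le: "2 * pi / L * sqrt ((real_of_int n1)\<^sup>2 + (real_of_int n2)\<^sup>2 + (real_of_int n3)\<^sup>2) \<le> Kmax"
    using assms unfolding momenta_def by blast
  have "-k = (2 * pi / L) *\<^sub>R vector [real_of_int (-n1), real_of_int (-n2), real_of_int (-n3)]"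
    by (simp add: k Finite_Cartesian_Product.vec_eq_iff forall_3)
  then show ?thesis
    unfolding momenta_def using le by (intro CollectI exI[of _ "-n1"] exI[of _ "-n2"] exI[of _ "-n3"]) simp
qed

theorem corollary6p5:
  fixes L Kmax m \<mu> hbar :: real
    and \<Lambda> :: "(real ^ 3) set" and ks :: "(real ^ 3) list"
    and U :: "real ^ 3 \<Rightarrow> real ^ 3 \<Rightarrow> real"
    and \<xi> \<Delta> E \<theta> :: "real ^ 3 \<Rightarrow> real"
    and k :: "real ^ 3"
  assumes "L > 0" and "Kmax > 0"
    and "\<Lambda> = momenta L Kmax"
    and "distinct ks" and "set ks = \<Lambda>"
    and "m > 0" and "\<mu> > 0" and "hbar > 0"
    and "\<xi> = xi hbar m \<mu>"
    and "\<And>k k'. k \<in> \<Lambda> \<Longrightarrow> k' \<in> \<Lambda> \<Longrightarrow> U k k' \<le> 0"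
    and "\<And>k k'. k \<in> \<Lambda> \<Longrightarrow> k' \<in> \<Lambda> \<Longrightarrow> U k' k = U k k'"
    and "\<And>k k'. k \<in> \<Lambda> \<Longrightarrow> k' \<in> \<Lambda> \<Longrightarrow> U (-k) (-k') = U k k'"
    and "\<And>k. k \<in> \<Lambda> \<Longrightarrow> U k k = 0"
    and "E = energy \<xi> \<Delta>"
    and "\<And>k. k \<in> \<Lambda> \<Longrightarrow> \<Delta> k \<ge> 0"
    and "\<And>k. k \<in> \<Lambda> \<Longrightarrow> \<Delta> (-k) = \<Delta> k"
    and "\<And>k. k \<in> \<Lambda> \<Longrightarrow> E k > 0"
    and "\<And>k. k \<in> \<Lambda> \<Longrightarrow>
      \<Delta> k = - 1 / 2 * (\<Sum>k'\<in>\<Lambda>. U k k' * (\<Delta> k' / E k')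
                 * (1 - 4 * D_mom \<Lambda> U \<xi> E k' / (D_total \<Lambda> U \<xi> E + 2)))"
    and "\<And>k. k \<in> \<Lambda> \<Longrightarrow> 0 \<le> \<theta> k \<and> \<theta> k \<le> pi / 2"
    and "\<And>k. k \<in> \<Lambda> \<Longrightarrow> sin (2 * \<theta> k) = \<Delta> k / E k"
    and "\<And>k. k \<in> \<Lambda> \<Longrightarrow> cos (2 * \<theta> k) = \<xi> k / E k"
    and "k \<in> \<Lambda>"
  shows "complex_of_real (\<Delta> k) =
    - (\<Sum>k'\<in>\<Lambda>. complex_of_real (U k k')
         * fock_inner (psi ks U E \<theta>)
             (annih ks (-k') Down * annih ks k' Up *\<^sub>v psi ks U E \<theta>))"
proof -
  interpret symmetric_momenta ks
    using assms(3-5) uminus_mem_momenta by unfold_locales auto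
  note ks = \<open>set ks = \<Lambda>\<close>
  \<comment> \<open>The coefficients for which \<open>phi\<close> is the rotated state
    \<open>two_pairs w\<close>, see \<open>phi_eq\<close>.\<close>
  define w where "w p q = U p q * ((cos (\<theta> p))\<^sup>2 * (sin (\<theta> q))\<^sup>2
      + (cos (\<theta> q))\<^sup>2 * (sin (\<theta> p))\<^sup>2) / (E p + E q)" for p q
  define D where "D = (\<Sum>p\<in>set ks. \<Sum>q\<in>set ks. (w p q)\<^sup>2)"
  define u where "u = vacuum ks + two_pairs w"
  define c where "c = 1 / sqrt (1 + D / 2)"
  have sym: "w q p = w p q" if "p \<in> set ks" "q \<in> set ks" for p q
    using that assms(11)[of p q] by (simp add: w_def ks add.commute)
  have diag: "w p p = 0" if "p \<in> set ks" for p
    using that assms(13) by (simp add: w_def ks)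
  have D0: "0 \<le> D" by (simp add: D_def sum_nonneg)
  \<comment> \<open>The 1/2 from \<open>cos_sin_mix\<close> is squared to the prefactor 1/4 of
    \<open>D_mom\<close>.\<close>
  have w2: "(w p q)\<^sup>2 = 1 / 4 * ((U p q)\<^sup>2 / (E p + E q)\<^sup>2 * (1 - \<xi> p * \<xi> q / (E p * E q))\<^sup>2)"
    if "p \<in> \<Lambda>" "q \<in> \<Lambda>" for p q
  proof -
    have "w p q = 1 / 2 * (U p q / (E p + E q) * (1 - \<xi> p * \<xi> q / (E p * E q)))"
      using that assms(21) unfolding w_def cos_sin_mix by simp
    then show ?thesis by (simp only: power_mult_distrib power_divide) simp
  qed
  have Dk: "(\<Sum>q\<in>set ks. (w p q)\<^sup>2) = D_mom \<Lambda> U \<xi> E p" if "p \<in> \<Lambda>" for p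
    using that by (simp add: D_mom_def ks w2 sum_distrib_left)
  then have D: "D = D_total \<Lambda> U \<xi> E"
    by (simp add: D_def D_total_def ks)
  have u: "u \<in> carrier_vec Nk" by (simp add: u_def)
  note expect = rotated_two_pair_expectation[of _ w \<theta>, OF _ sym diag, folded D_def u_def]
  have phi: "phi ks U E \<theta> = bogoliubov \<theta> *\<^sub>v two_pairs w"
    by (simp add: phi_eq w_def[abs_def])
  \<comment> \<open>The norm formula \<open>expect(1)\<close> carries the premise that some momentum
    lies in \<open>set ks\<close>; \<open>k\<close> serves for it.\<close>
  have "k \<in> set ks" using \<open>k \<in> \<Lambda>\<close> ks by simp
  then have "Re (fock_inner (phi ks U E \<theta>) (phi ks U E \<theta>)) = D / 2"
    by (simp only: phi expect(1) Re_complex_of_real)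
  moreover have "psi_BCS ks \<theta> + phi ks U E \<theta> = bogoliubov \<theta> *\<^sub>v u"
    unfolding phi psi_BCS_eq u_def
    by (rule mult_add_distrib_mat_vec[symmetric, of _ Nk Nk]) auto
  ultimately have "psi ks U E \<theta> = complex_of_real c \<cdot>\<^sub>v (bogoliubov \<theta> *\<^sub>v u)"
    by (simp only: psi_def c_def)
  moreover have "bogoliubov \<theta> *\<^sub>v u \<in> carrier_vec Nk"
    using u by (intro mult_mat_vec_carrier[of _ Nk Nk]) auto
  ultimately have psi: "fock_inner (psi ks U E \<theta>) (pair_op ks p *\<^sub>v psi ks U E \<theta>)
      = c\<^sup>2 * fock_inner (bogoliubov \<theta> *\<^sub>v u) (pair_op ks p *\<^sub>v (bogoliubov \<theta> *\<^sub>v u))" if "p \<in> \<Lambda>" for p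
    using that by (simp add: mult_mat_vec[of _ Nk Nk] fock_inner_smult_left[of _ Nk]
        fock_inner_smult_right[of _ Nk] ks power2_eq_square)
  have gap: "fock_inner (psi ks U E \<theta>) (pair_op ks p *\<^sub>v psi ks U E \<theta>)
      = of_real (1 / 2 * (\<Delta> p / E p) * (1 - 4 * D_mom \<Lambda> U \<xi> E p / (D_total \<Lambda> U \<xi> E + 2)))"
    if "p \<in> \<Lambda>" for p
  proof -
    \<comment> \<open>\<open>D0\<close> makes the squared root equal to its radicand
      \<open>1 + D / 2\<close>. Multiplying
      \<open>1 + D / 2 - 2 * D_mom \<Lambda> U \<xi> E p\<close> by this value gives exactly the
      bracket of the gap equation.\<close>
    have c2: "c\<^sup>2 = 2 / (D + 2)"
      using D0 by (simp add: c_def power_divide field_simps)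
    have "D + 2 \<noteq> 0" using D0 by simp
    have p: "p \<in> set ks" using that ks by simp
    have "fock_inner (psi ks U E \<theta>) (pair_op ks p *\<^sub>v psi ks U E \<theta>)
        = of_real (c\<^sup>2 * (sin (2 * \<theta> p) / 2 * (1 + D / 2 - 2 * D_mom \<Lambda> U \<xi> E p)))"
      by (simp only: psi[OF that] expect(2)[OF p] Dk[OF that] of_real_mult of_real_power)
    also have "c\<^sup>2 * (sin (2 * \<theta> p) / 2 * (1 + D / 2 - 2 * D_mom \<Lambda> U \<xi> E p))
        = 1 / 2 * (\<Delta> p / E p) * (1 - 4 * D_mom \<Lambda> U \<xi> E p / (D + 2))"
      unfolding c2 assms(20)[OF that] using \<open>D + 2 \<noteq> 0\<close> by (simp add: divide_simps)
    finally show ?thesis by (simp only: D)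
  qed
  have "- (\<Sum>k'\<in>\<Lambda>. complex_of_real (U k k') * fock_inner (psi ks U E \<theta>)
             (annih ks (-k') Down * annih ks k' Up *\<^sub>v psi ks U E \<theta>))
      = of_real (- (\<Sum>k'\<in>\<Lambda>. U k k' * (1 / 2 * (\<Delta> k' / E k')
          * (1 - 4 * D_mom \<Lambda> U \<xi> E k' / (D_total \<Lambda> U \<xi> E + 2)))))"
    by (simp add: gap flip: pair_op_def)
  \<comment> \<open>This is the right-hand side of the new gap equation with its factor 1/2 moved
    inside the sum.\<close>
  also have "- (\<Sum>k'\<in>\<Lambda>. U k k' * (1 / 2 * (\<Delta> k' / E k')
          * (1 - 4 * D_mom \<Lambda> U \<xi> E k' / (D_total \<Lambda> U \<xi> E + 2)))) = \<Delta> k"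
    unfolding assms(18)[OF \<open>k \<in> \<Lambda>\<close>] by (simp add: sum_distrib_left sum_negf mult_ac)
  finally show ?thesis by simp
qed

end
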